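(* Let $n\ge1$, $p>1$, $\mu>0$, $\lambda>0$, $\sigma\in\{1,-1\}$, and let $\phi=\phi(x,t)\in C([0,\infty);L^q(\mathbb{R}^n))$, $2\le q<\infty$, be a global weak solution of the equation $$\phi_{tt}+n\phi_t-e^{-2t}\Delta\phi=\mu^2\phi-\lambda|\phi|^{p-1}\phi.$$ Put $C_0(\phi)=\int_{\mathbb{R}^n}\phi(x,0)\,dx$ and $C_1(\phi)=\int_{\mathbb{R}^n}\phi_t(x,0)\,dx$, and assume that $$\sigma\left(\left(\sqrt{\frac{n^2}{4}+\mu^2}+\frac n2\right)C_0(\phi)+C_1(\phi)\right)>0,$$ while $$\sigma\int_{\mathbb{R}^n}|\phi(x,t)|^{p-1}\phi(x,t)\,dx\le0$$ is fulfilled for all $t$ outside of a sufficiently small neighborhood of zero. Then the global solution $\phi$ cannot be asymptotically time-weighted $L^p$-non-positive if $\sigma=1$ (respectively, asymptotically time-weighted $L^p$-non-negative if $\sigma=-1$) with the weight $\nu_\phi(t)=e^{a_\phi t}t^{b_\phi}$, where either $a_\phi<(p-1)\left(\sqrt{\frac{n^2}{4}+\mu^2}-\frac n2\right)$ and $b_\phi\in\mathbb{R}$, or $a_\phi=(p-1)\left(\sqrt{\frac{n^2}{4}+\mu^2}-\frac n2\right)$ and $b_\phi<-2$.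
   Context: Weak solutions. Set $M=\sqrt{\frac{n^2}{4}+\mu^2}$ and $u=e^{\frac n2t}\phi$; then the equation for $\phi$ becomes $u_{tt}-e^{-2t}\Delta u-M^2u=-\lambda e^{-\frac{n(p-1)}2t}|u|^{p-1}u$. $\phi$ is a global weak solution if $u$ satisfies the integral equation $u=u_0-G[\lambda e^{-\frac{n(p-1)}2\cdot}|u|^{p-1}u]$ on $[0,\infty)$, with $u\in\bigcap_{i=1,p,q}C([0,T];L^i(\mathbb{R}^n))$ for every $T>0$, where $u_0$ solves $\partial_t^2u_0-e^{-2t}\Delta u_0-M^2u_0=0$ with $u_0(x,0)=u(x,0)$, $\partial_tu_0(x,0)=\partial_tu(x,0)$ (with $u_0\in C([0,T];L^{q'}(\mathbb{R}^n))$, $q'\ge q>1$), and $G$ is the resolving operator ($G[f]=w$) of the Cauchy problem $w_{tt}-e^{-2t}\Delta w-M^2w=f$, $w(x,0)=w_t(x,0)=0$. Definition. A function $\phi\in C([0,\infty);L^p(\mathbb{R}^n))$ is asymptotically time-weighted $L^p$-non-positive (respectively non-negative) with weight $\nu_\phi$ (a positive non-decreasing continuous function) if there is a number $C_\phi\ge0$ such that, with $\sigma=1$ (respectively $\sigma=-1$), $$\left|\int_{\mathbb{R}^n}\phi(x,t)\,dx\right|^p\le-\sigma C_\phi\,\nu_\phi(t)\int_{\mathbb{R}^n}|\phi(x,t)|^{p-1}\phi(x,t)\,dx\quad\text{for all sufficiently large }t.$$ For $\nu_\phi(t)=e^{a_\phi t}t^{b_\phi}$ only large values of $t$ matter. "Outside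 of a sufficiently small neighborhood of zero" means: there are $\delta>0$ and $\varepsilon\in[0,1)$ such that the inequality holds for all $t\ge\delta$ and, for all large $t$, $$\lambda\left|\int_0^\delta e^{\frac n2b}\Big(\int_{\mathbb{R}^n}|\phi(x,b)|^{p-1}\phi(x,b)\,dx\Big)\frac1M\sinh(M(t-b))\,db\right|\le\varepsilon\cosh(Mt).$$
   Formalization: In "outside of a sufficiently small neighborhood of zero", ε must also satisfy ε < σ((M+n/2)C_0+C_1)/M, with M=√(n²/4+μ²); with ε<1 alone the claim fails, since rescaling φ and λ makes that bound no restriction. *)

theory Defs
  imports "HOL-Analysis.Analysis"
begin

text \<open>
  Functions of \<open>(x, t)\<close> are curried with time first, \<open>phi t x\<close>, and only their values for
  \<open>t \<ge> 0\<close> are used; space is \<^typ>\<open>real^'n\<close>, so that \<open>n = CARD('n)\<close>.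
\<close>

definition mass :: "nat \<Rightarrow> real \<Rightarrow> real" where
  "mass n mu = sqrt ((real n)\<^sup>2 / 4 + mu\<^sup>2)"

subsection \<open>The spaces \<open>C([0,\<infinity>); L\<^sup>r)\<close>\<close>

definition in_Lp :: "real \<Rightarrow> (real^'n \<Rightarrow> real) \<Rightarrow> bool" where
  "in_Lp r f \<longleftrightarrow> f \<in> borel_measurable lebesgue \<and> integrable lebesgue (\<lambda>x. \<bar>f x\<bar> powr r)"

definition Lp_norm :: "real \<Rightarrow> (real^'n \<Rightarrow> real) \<Rightarrow> real" where
  "Lp_norm r f = (LINT x|lebesgue. \<bar>f x\<bar> powr r) powr (1 / r)"

definition continuous_Lp :: "real \<Rightarrow> (real \<Rightarrow> real^'n \<Rightarrow> real) \<Rightarrow> bool" where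
  "continuous_Lp r v \<longleftrightarrow>
     (\<forall>t\<ge>0. in_Lp r (v t)) \<and>
     (\<forall>s\<ge>0. ((\<lambda>t. Lp_norm r (\<lambda>x. v t x - v s x)) \<longlongrightarrow> 0) (at s within {0..}))"

definition locally_integrable :: "(real^'n \<Rightarrow> real) \<Rightarrow> bool" where
  "locally_integrable f \<longleftrightarrow> (\<forall>K. compact K \<longrightarrow> set_integrable lebesgue K f)"

subsection \<open>Test functions\<close>

definition partial :: "'n \<Rightarrow> (real^'n \<Rightarrow> real) \<Rightarrow> real^'n \<Rightarrow> real" where
  "partial i f x = frechet_derivative f (at x) (axis i 1)"

fun C_k :: "nat \<Rightarrow> (real^'n \<Rightarrow> real) \<Rightarrow> bool" where
  "C_k 0 f \<longleftrightarrow> continuous_on UNIV f"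
| "C_k (Suc k) f \<longleftrightarrow> (\<forall>x. f differentiable (at x)) \<and> (\<forall>i. C_k k (partial i f))"

definition laplacian :: "(real^'n \<Rightarrow> real) \<Rightarrow> real^'n \<Rightarrow> real" where
  "laplacian f x = (\<Sum>i\<in>UNIV. partial i (partial i f) x)"

definition test_function :: "(real^'n \<Rightarrow> real) \<Rightarrow> bool" where
  "test_function \<psi> \<longleftrightarrow> (\<forall>k. C_k k \<psi>) \<and> compact (closure {x. \<psi> x \<noteq> 0})"

definition pairing :: "(real^'n \<Rightarrow> real) \<Rightarrow> (real^'n \<Rightarrow> real) \<Rightarrow> real" where
  "pairing f \<psi> = (LINT x|lebesgue. f x * \<psi> x)"

subsection \<open>The Cauchy problem and weak solutions\<close>

text \<open>\<open>v\<^sub>t(\<cdot>,0) = v1\<close> in the sense of distributions on space (a one-sided derivative in time).\<close>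

definition initial_velocity :: "(real \<Rightarrow> real^'n \<Rightarrow> real) \<Rightarrow> (real^'n \<Rightarrow> real) \<Rightarrow> bool" where
  "initial_velocity v v1 \<longleftrightarrow> locally_integrable v1 \<and>
     (\<forall>\<psi>. test_function \<psi> \<longrightarrow>
        ((\<lambda>t. pairing (v t) \<psi>) has_real_derivative pairing v1 \<psi>) (at 0 within {0..}))"

text \<open>
  \<open>w\<^sub>t\<^sub>t - e\<^bsup>-2t\<^esup> \<Delta>w - M\<^sup>2w = f\<close> for \<open>t \<ge> 0\<close>, with \<open>w(\<cdot>,0) = w0\<close> and \<open>w\<^sub>t(\<cdot>,0) = w1\<close>, in the sense of
  distributions: for every test function \<open>\<psi>\<close> the function \<open>t \<mapsto> \<langle>w(t), \<psi>\<rangle>\<close> is twice differentiable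
  and satisfies the equation tested against \<open>\<psi>\<close>. For a source that is continuous in time with
  values in some \<open>L\<^sup>r\<close> this is the usual space-time distributional formulation.
\<close>

definition solves_cauchy ::
  "real \<Rightarrow> (real \<Rightarrow> real^'n \<Rightarrow> real) \<Rightarrow> (real^'n \<Rightarrow> real) \<Rightarrow> (real^'n \<Rightarrow> real) \<Rightarrow>
   (real \<Rightarrow> real^'n \<Rightarrow> real) \<Rightarrow> bool" where
  "solves_cauchy M f w0 w1 w \<longleftrightarrow>
     (\<forall>t\<ge>0. locally_integrable (w t)) \<and>
     (AE x in lebesgue. w 0 x = w0 x) \<and>
     initial_velocity w w1 \<and>
     (\<forall>\<psi>. test_function \<psi> \<longrightarrow>
       (\<exists>d. \<forall>t\<ge>0.
          ((\<lambda>s. pairing (w s) \<psi>) has_real_derivative d t) (at t within {0..}) \<and>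
          (d has_real_derivative
             exp (- 2 * t) * pairing (w t) (laplacian \<psi>) + M\<^sup>2 * pairing (w t) \<psi> + pairing (f t) \<psi>)
            (at t within {0..})))"

text \<open>
  The resolving operator \<open>G\<close> as a relation, \<open>G[f] = w\<close>; by finite speed of propagation \<open>w\<close> is
  determined by \<open>f\<close> up to null sets at each time.
\<close>

definition resolves :: "real \<Rightarrow> (real \<Rightarrow> real^'n \<Rightarrow> real) \<Rightarrow> (real \<Rightarrow> real^'n \<Rightarrow> real) \<Rightarrow> bool" where
  "resolves M f w \<longleftrightarrow> solves_cauchy M f (\<lambda>x. 0) (\<lambda>x. 0) w"

definition global_weak_solution ::
  "real \<Rightarrow> real \<Rightarrow> real \<Rightarrow> real \<Rightarrow> (real \<Rightarrow> real^'n \<Rightarrow> real) \<Rightarrow> bool" where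
  "global_weak_solution p q mu lam phi \<longleftrightarrow>
     (let n = real CARD('n);
          M = mass CARD('n) mu;
          u = (\<lambda>t x. exp (n / 2 * t) * phi t x)
      in (\<forall>r\<in>{1, p, q}. continuous_Lp r u) \<and>
         (\<exists>u0 u1 w q'. q' \<ge> q \<and> continuous_Lp q' u0 \<and>
            initial_velocity u u1 \<and>
            solves_cauchy M (\<lambda>t x. 0) (u 0) u1 u0 \<and>
            resolves M (\<lambda>t x. lam * exp (- (n * (p - 1) / 2 * t)) * (\<bar>u t x\<bar> powr (p - 1) * u t x)) w \<and>
            (\<forall>t\<ge>0. AE x in lebesgue. u t x = u0 t x - w t x)))"

subsection \<open>Sign conditions\<close>

definition nonlin_integral :: "real \<Rightarrow> (real \<Rightarrow> real^'n \<Rightarrow> real) \<Rightarrow> real \<Rightarrow> real" where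
  "nonlin_integral p phi t = (LINT x|lebesgue. \<bar>phi t x\<bar> powr (p - 1) * phi t x)"

text \<open>
  Non-positive for \<open>\<sigma> = 1\<close>, non-negative for \<open>\<sigma> = -1\<close>. No regularity or monotonicity of the weight
  \<open>nu\<close> is built in: for \<open>nu(t) = e\<^bsup>at\<^esup> t\<^bsup>b\<^esup>\<close> only large \<open>t\<close> matter, and all real \<open>a\<close>, \<open>b\<close> are to be
  admitted.
\<close>

definition asymptotically_weighted ::
  "real \<Rightarrow> real \<Rightarrow> (real \<Rightarrow> real) \<Rightarrow> (real \<Rightarrow> real^'n \<Rightarrow> real) \<Rightarrow> bool" where
  "asymptotically_weighted \<sigma> p nu phi \<longleftrightarrow>
     (\<exists>C\<ge>0. \<forall>\<^sub>F t in at_top.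
        \<bar>LINT x|lebesgue. phi t x\<bar> powr p \<le> - \<sigma> * C * nu t * nonlin_integral p phi t)"

definition sign_condition_outside ::
  "real \<Rightarrow> real \<Rightarrow> real \<Rightarrow> real \<Rightarrow> real \<Rightarrow> real \<Rightarrow> (real \<Rightarrow> real^'n \<Rightarrow> real) \<Rightarrow> bool" where
  "sign_condition_outside \<delta> \<epsilon> p mu lam \<sigma> phi \<longleftrightarrow>
     (let n = real CARD('n); M = mass CARD('n) mu
      in (\<forall>t\<ge>\<delta>. \<sigma> * nonlin_integral p phi t \<le> 0) \<and>
         (\<forall>\<^sub>F t in at_top.
            lam * \<bar>integral {0..\<delta>}
                     (\<lambda>b. exp (n / 2 * b) * nonlin_integral p phi b * (1 / M * sinh (M * (t - b))))\<bar>
              \<le> \<epsilon> * cosh (M * t)))"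

text \<open>
  The Cauchy data enter through \<open>A = \<sigma> ((M + n/2) C\<^sub>0 + C\<^sub>1) / M\<close>: the space integral of the
  homogeneous part of \<open>\<sigma> u\<close> is \<open>A cosh(Mt) + O(e\<^bsup>-Mt\<^esup>)\<close>. A neighbourhood \<open>[0,\<delta>)\<close> of zero is
  sufficiently small if its contribution, at most \<open>\<epsilon> cosh(Mt)\<close> with \<open>\<epsilon> < 1\<close>, cannot outweigh this
  leading term, that is \<open>\<epsilon> < A\<close>. The bound \<open>\<epsilon> < 1\<close> alone is not a restriction, because replacing
  \<open>(phi, lam)\<close> by \<open>(c phi, c\<^bsup>1-p\<^esup> lam)\<close> multiplies both the contribution and \<open>A\<close> by \<open>c\<close>.
\<close>

definition sign_condition_outside_small_nbhd ::
  "real \<Rightarrow> real \<Rightarrow> real \<Rightarrow> real \<Rightarrow> real \<Rightarrow> (real \<Rightarrow> real^'n \<Rightarrow> real) \<Rightarrow> bool" where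
  "sign_condition_outside_small_nbhd A p mu lam \<sigma> phi \<longleftrightarrow>
     (\<exists>\<delta>>0. \<exists>\<epsilon>. 0 \<le> \<epsilon> \<and> \<epsilon> < 1 \<and> \<epsilon> < A \<and> sign_condition_outside \<delta> \<epsilon> p mu lam \<sigma> phi)"

end

theory Submission
  imports Defs "HOL-Real_Asymp.Real_Asymp"
begin

text \<open>
  Testing the equation against cutoffs that tend to 1 shows that \<open>W(t) = \<sigma> \<integral> u(x,t) dx\<close> satisfies
  \<open>W(t) = A cosh(Mt) + O(e\<^bsup>-Mt\<^esup>) + lam \<integral> sinh(M(t - s))/M K(s) ds\<close> over \<open>0 \<le> s \<le> t\<close>, with
  \<open>K(s) = - \<sigma> e\<^bsup>ns/2\<^esup> \<integral> |phi|\<^bsup>p-1\<^esup> phi dx\<close>. By the sign condition the integral cannot outweigh \<open>A cosh(Mt)\<close>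
  near \<open>s = 0\<close> and is non-negative afterwards, so \<open>W\<close> grows at least like \<open>e\<^bsup>Mt\<^esup>\<close>. Since
  \<open>e\<^bsup>at\<^esup> t\<^bsup>b\<^esup> \<le> e\<^bsup>(p-1)(M-n/2)t\<^esup>\<close> for large \<open>t\<close>, the weighted sign property of \<open>phi\<close> would give
  \<open>K(s) \<ge> \<kappa> e\<^bsup>-(p-1)Ms\<^esup> W(s)\<^sup>p\<close> for large \<open>s\<close>, and these two facts force \<open>W\<close> to blow up in finite time.
\<close>

subsection \<open>Cutoff functions\<close>

text \<open>The function \<open>exp (- (1 / s))\<close>, continued by zero to the left of 0, is the
  classical smooth but non-analytic profile. A polynomial in \<open>1 / s\<close> is carried along
  so that every derivative has the same form again.\<close>

definition flat :: "real poly \<Rightarrow> real \<Rightarrow> real" where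
  "flat P s = (if s > 0 then poly P (1 / s) * exp (- (1 / s)) else 0)"

text \<open>This is the difference quotient at 0, where the two pieces meet. In the variable
  \<open>1 / s\<close> it is a polynomial against a decaying exponential.\<close>

lemma flat_div_tendsto: "((\<lambda>s. flat P s / s) \<longlongrightarrow> 0) (at 0)"
proof -
  have "((\<lambda>s::real. poly P (1 / s) * exp (- (1 / s)) / s) \<longlongrightarrow> 0) (at_right 0)"
  proof -
    have *: "((\<lambda>s::real. (1 / s) ^ i * exp (- (1 / s)) / s) \<longlongrightarrow> 0) (at_right 0)" for i
    proof -
      have "((\<lambda>y::real. y ^ Suc i / exp y) \<longlongrightarrow> 0) at_top"
        by (rule tendsto_power_div_exp_0)
      then have "((\<lambda>s::real. (inverse s) ^ Suc i / exp (inverse s)) \<longlongrightarrow> 0) (at_right 0)"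
        by (rule filterlim_compose[OF _ filterlim_inverse_at_top_right])
      then show ?thesis
        by (rule Lim_transform_eventually)
          (auto simp: eventually_at_filter exp_minus field_simps intro!: always_eventually)
    qed
    have "((\<lambda>s::real. \<Sum>i\<le>degree P. coeff P i * ((1 / s) ^ i * exp (- (1 / s)) / s)) \<longlongrightarrow>
        (\<Sum>i\<le>degree P. coeff P i * 0)) (at_right 0)"
      by (intro tendsto_intros *)
    then show ?thesis
      by (simp add: poly_altdef sum_distrib_right sum_divide_distrib mult.assoc)
  qed
  then have r: "((\<lambda>s. flat P s / s) \<longlongrightarrow> 0) (at_right 0)"
    by (rule Lim_transform_eventually) (auto simp: flat_def eventually_at_filter)
  have l: "((\<lambda>s. flat P s / s) \<longlongrightarrow> 0) (at_left 0)"
    by (rule Lim_transform_eventually[OF tendsto_const]) (auto simp: flat_def eventually_at_filter)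
  show ?thesis
    using filterlim_split_at[OF l r] .
qed

text \<open>With \<open>y = 1 / s\<close> the chain rule turns \<open>P(y) exp(-y)\<close> into
  \<open>y^2 (P(y) - P'(y)) exp(-y)\<close>, and \<open>[:0, 0, 1:]\<close> is
  \<open>y^2\<close>.\<close>

lemma flat_has_derivative:
  "(flat P has_real_derivative flat ([:0, 0, 1:] * (P - pderiv P)) s) (at s)"
proof -
  consider "s > 0" | "s < 0" | "s = 0" by linarith
  then show ?thesis
  proof cases
    case 1
    have "((\<lambda>s. poly P (1 / s) * exp (- (1 / s))) has_real_derivative
        flat ([:0, 0, 1:] * (P - pderiv P)) s) (at s)"
      using 1
      by (auto simp: flat_def field_simps power2_eq_square
          intro!: derivative_eq_intros DERIV_chain2[OF poly_DERIV])
    then show ?thesis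
      by (rule has_field_derivative_transform_within_open[of _ _ _ "{0<..}"])
        (use 1 in \<open>auto simp: flat_def\<close>)
  next
    case 2
    have "((\<lambda>s. 0) has_real_derivative flat ([:0, 0, 1:] * (P - pderiv P)) s) (at s)"
      using 2 by (auto simp: flat_def)
    then show ?thesis
      by (rule has_field_derivative_transform_within_open[of _ _ _ "{..<0}"])
        (use 2 in \<open>auto simp: flat_def\<close>)
  next
    case 3
    have z: "flat Q 0 = 0" for Q by (simp add: flat_def)
    show ?thesis
      unfolding 3 z has_field_derivative_iff using flat_div_tendsto[of P] by (simp add: z)
  qed
qed

text \<open>Closure of this algebra under \<^const>\<open>partial\<close> gives smoothness of its members at once.\<close>

inductive_set bump_algebra :: "(real^'n \<Rightarrow> real) set" where
  bump: "(\<lambda>x. flat P (1 - x \<bullet> x)) \<in> bump_algebra"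
| const: "(\<lambda>x. c) \<in> bump_algebra"
| coord: "(\<lambda>x. x $ j) \<in> bump_algebra"
| add: "f \<in> bump_algebra \<Longrightarrow> g \<in> bump_algebra \<Longrightarrow> (\<lambda>x. f x + g x) \<in> bump_algebra"
| mult: "f \<in> bump_algebra \<Longrightarrow> g \<in> bump_algebra \<Longrightarrow> (\<lambda>x. f x * g x) \<in> bump_algebra"

lemma partial_eqI: "(f has_derivative f') (at x) \<Longrightarrow> partial i f x = f' (axis i 1)"
  unfolding partial_def by (metis frechet_derivative_at)

text \<open>The generator \<open>bump\<close> carries the content: its derivative is another
  \<open>flat\<close> profile times a coordinate. Sums and products use differentiability and
  closure of both operands, hence the joint induction.\<close>

lemma bump_algebra_closed:
  fixes f :: "real^'n \<Rightarrow> real"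
  assumes "f \<in> bump_algebra"
  shows "(\<forall>x. f differentiable (at x)) \<and> (\<forall>i. partial i f \<in> bump_algebra)"
  using assms
proof induction
  case (bump P)
  let ?Q = "[:0, 0, 1:] * (P - pderiv P)"
  have D: "((\<lambda>x. flat P (1 - x \<bullet> x)) has_derivative
      (\<lambda>h. flat ?Q (1 - x \<bullet> x) * (- 2 * (x \<bullet> h)))) (at x)" for x :: "real^'n"
  proof -
    have "((\<lambda>x. 1 - x \<bullet> x) has_derivative (\<lambda>h. - 2 * (x \<bullet> h))) (at x)"
      by (auto intro!: derivative_eq_intros simp: inner_commute)
    from has_derivative_compose[OF this
        flat_has_derivative[of P "1 - x \<bullet> x", unfolded has_field_derivative_def]]
    show ?thesis by simp
  qed
  have "partial i (\<lambda>x. flat P (1 - x \<bullet> x)) = (\<lambda>x. flat ?Q (1 - x \<bullet> x) * (- 2 * x $ i))"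
    for i :: 'n
    by (rule ext, subst partial_eqI[OF D]) (simp add: inner_axis)
  moreover have "(\<lambda>x. flat ?Q (1 - x \<bullet> x) * (- 2 * x $ i)) \<in> bump_algebra" for i :: 'n
    by (intro bump_algebra.intros)
  ultimately show ?case
    using D by (auto simp: differentiable_def)
next
  case (const c)
  have "partial i (\<lambda>x. c) = (\<lambda>x. 0)" for i :: 'n
    by (rule ext, rule partial_eqI) simp
  then show ?case by (auto intro: bump_algebra.intros)
next
  case (coord j)
  have D: "((\<lambda>x. x $ j) has_derivative (\<lambda>h. h $ j)) (at x)" for x :: "real^'n"
    by (intro bounded_linear_imp_has_derivative bounded_linear_vec_nth)
  then have "partial i (\<lambda>x. x $ j) = (\<lambda>x. axis i 1 $ j)" for i :: 'n
    by (intro ext partial_eqI)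
  with D show ?case by (auto simp: differentiable_def intro: bump_algebra.intros)
next
  case (add f g)
  have "partial i (\<lambda>x. f x + g x) = (\<lambda>x. partial i f x + partial i g x)" for i :: 'n
    using add.IH unfolding partial_def
    by (intro ext partial_eqI[unfolded partial_def] has_derivative_add)
      (auto simp: frechet_derivative_works[symmetric])
  with add show ?case by (auto intro: bump_algebra.intros)
next
  case (mult f g)
  have "partial i (\<lambda>x. f x * g x) = (\<lambda>x. f x * partial i g x + partial i f x * g x)" for i :: 'n
    using mult.IH unfolding partial_def
    by (intro ext partial_eqI[unfolded partial_def] has_derivative_mult)
      (auto simp: frechet_derivative_works[symmetric])
  with mult show ?case by (auto intro!: bump_algebra.add intro: bump_algebra.mult)
qed

lemma bump_algebra_C_k: "f \<in> bump_algebra \<Longrightarrow> C_k k f"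
proof (induction k arbitrary: f)
  case 0
  then show ?case
    using bump_algebra_closed[OF 0] differentiable_imp_continuous_within
    by (auto simp: continuous_on_eq_continuous_within)
next
  case (Suc k)
  then show ?case using bump_algebra_closed by auto
qed

lemma ex_test_function:
  obtains \<psi> :: "real^'n \<Rightarrow> real" where "test_function \<psi>" "\<psi> 0 = 1"
proof
  \<comment> \<open>The constant polynomial normalises the value at the origin:
    \<open>exp 1 * exp (- 1) = 1\<close>.\<close>
  let ?\<psi> = "\<lambda>x::real^'n. flat [:exp 1:] (1 - x \<bullet> x)"
  have "{x. ?\<psi> x \<noteq> 0} \<subseteq> cball 0 1"
    by (auto simp: flat_def dot_square_norm abs_square_less_1 split: if_splits)
  then have "bounded {x. ?\<psi> x \<noteq> 0}"
    using bounded_cball bounded_subset by blast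
  then show "test_function ?\<psi>"
    unfolding test_function_def
    by (auto intro: bump_algebra_C_k bump_algebra.intros simp: compact_closure)
  show "?\<psi> 0 = 1"
    by (simp add: flat_def flip: exp_add)
qed

section \<open>Dilation and support of test functions\<close>

lemma partial_scale:
  assumes "\<forall>x. f differentiable (at x)"
  shows "partial i (\<lambda>x. a * f (c *\<^sub>R x)) = (\<lambda>x. (a * c) * partial i f (c *\<^sub>R x))"
    and "(\<lambda>x. a * f (c *\<^sub>R x)) differentiable (at x)"
proof -
  have D: "((\<lambda>x. a * f (c *\<^sub>R x)) has_derivative
      (\<lambda>h. a * frechet_derivative f (at (c *\<^sub>R x)) (c *\<^sub>R h))) (at x)" for x
  proof -
    have "((\<lambda>x. c *\<^sub>R x) has_derivative (\<lambda>h. c *\<^sub>R h)) (at x)"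
      by (rule has_derivative_scaleR_right[OF has_derivative_ident])
    moreover have "(f has_derivative frechet_derivative f (at (c *\<^sub>R x))) (at (c *\<^sub>R x))"
      using assms frechet_derivative_works by blast
    ultimately show ?thesis
      by (rule has_derivative_mult_right[OF has_derivative_compose])
  qed
  then show "(\<lambda>x. a * f (c *\<^sub>R x)) differentiable (at x)"
    by (auto simp: differentiable_def)
  have "linear (frechet_derivative f (at y))" for y
    using assms by (simp add: linear_frechet_derivative)
  then show "partial i (\<lambda>x. a * f (c *\<^sub>R x)) = (\<lambda>x. (a * c) * partial i f (c *\<^sub>R x))"
    using partial_eqI[OF D] by (auto simp: partial_def linear_scale)
qed

text \<open>The prefactor \<open>a\<close> stays arbitrary in the induction because every derivative
  multiplies it by \<open>c\<close>.\<close>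

lemma C_k_scale: "C_k k f \<Longrightarrow> C_k k (\<lambda>x. a * f (c *\<^sub>R x))"
proof (induction k arbitrary: f a)
  case 0
  then have "continuous_on UNIV (\<lambda>x. f (c *\<^sub>R x))"
    using continuous_on_compose2[of UNIV f UNIV "\<lambda>x. c *\<^sub>R x"]
    by (simp add: continuous_on_scaleR)
  then show ?case by (simp add: continuous_on_mult_left)
next
  case (Suc k)
  then have d: "\<forall>x. f differentiable (at x)" and "\<And>i. C_k k (partial i f)" by auto
  then have "C_k k (partial i (\<lambda>x. a * f (c *\<^sub>R x)))" for i
    unfolding partial_scale(1)[OF d] by (intro Suc.IH)
  then show ?case
    unfolding C_k.simps using partial_scale(2)[OF d] by blast
qed

lemma test_function_differentiable:
  assumes "test_function \<psi>"
  shows "\<forall>x. \<psi> differentiable (at x)" "\<forall>x. partial i \<psi> differentiable (at x)"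
    "continuous_on UNIV \<psi>" "continuous_on UNIV (laplacian \<psi>)"
proof -
  have "C_k 0 \<psi>" "C_k (Suc (Suc 0)) \<psi>" using assms by (auto simp: test_function_def simp del: C_k.simps)
  then show "\<forall>x. \<psi> differentiable (at x)" "\<forall>x. partial i \<psi> differentiable (at x)"
    "continuous_on UNIV \<psi>" "continuous_on UNIV (laplacian \<psi>)"
    by (auto simp: laplacian_def[abs_def] intro!: continuous_intros)
qed

text \<open>For small \<open>c\<close> the dilation widens a cutoff while the factor
  \<open>c\<^sup>2\<close> makes its Laplacian small. The new support is the old one stretched by
  \<open>1 / c\<close>, hence still bounded.\<close>

lemma test_function_scale:
  assumes "test_function \<psi>" "c \<noteq> 0"
  shows "test_function (\<lambda>x. \<psi> (c *\<^sub>R x))"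
    and "laplacian (\<lambda>x. \<psi> (c *\<^sub>R x)) x = c\<^sup>2 * laplacian \<psi> (c *\<^sub>R x)"
proof -
  have "bounded (closure {x. \<psi> x \<noteq> 0})"
    using assms(1) compact_imp_bounded by (auto simp: test_function_def)
  then have "bounded {x. \<psi> x \<noteq> 0}"
    using bounded_subset closure_subset by blast
  then have "bounded ((\<lambda>x. (1 / c) *\<^sub>R x) ` {x. \<psi> x \<noteq> 0})"
    by (rule bounded_scaling)
  moreover have "{x. \<psi> (c *\<^sub>R x) \<noteq> 0} \<subseteq> (\<lambda>x. (1 / c) *\<^sub>R x) ` {x. \<psi> x \<noteq> 0}"
    using assms(2) by (auto intro!: image_eqI[where x = "c *\<^sub>R _"])
  ultimately have "bounded {x. \<psi> (c *\<^sub>R x) \<noteq> 0}"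
    using bounded_subset by blast
  then show "test_function (\<lambda>x. \<psi> (c *\<^sub>R x))"
    using assms C_k_scale[of _ \<psi> 1 c] by (auto simp: test_function_def compact_closure)
  have p1: "partial i (\<lambda>x. \<psi> (c *\<^sub>R x)) = (\<lambda>x. c * partial i \<psi> (c *\<^sub>R x))" for i
    using partial_scale(1)[of \<psi> i 1 c] test_function_differentiable(1)[OF assms(1)] by simp
  show "laplacian (\<lambda>x. \<psi> (c *\<^sub>R x)) x = c\<^sup>2 * laplacian \<psi> (c *\<^sub>R x)"
    unfolding laplacian_def p1
    by (simp add: partial_scale(1) test_function_differentiable(2)[OF assms(1)]
        sum_distrib_left power2_eq_square)
qed

lemma partial_eq_0:
  assumes "x \<notin> closure {x. f x \<noteq> 0}"
  shows "partial i f x = 0"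
proof (rule partial_eqI[of f "\<lambda>h. 0"])
  have "((\<lambda>x. 0) has_derivative (\<lambda>h. 0)) (at x)" by simp
  then show "(f has_derivative (\<lambda>h. 0)) (at x)"
    by (rule has_derivative_transform_within_open[where s = "- closure {x. f x \<noteq> 0}"])
      (use assms closure_subset[of "{x. f x \<noteq> 0}"] in auto)
qed

text \<open>A partial derivative does not enlarge the closed support, so \<open>partial_eq_0\<close>
  applies twice. One compact set then serves for a test function and its Laplacian.\<close>

lemma laplacian_eq_0:
  assumes "x \<notin> closure {x. f x \<noteq> 0}"
  shows "laplacian f x = 0"
proof -
  have "closure {x. partial i f x \<noteq> 0} \<subseteq> closure {x. f x \<noteq> 0}" for i
    using partial_eq_0 by (intro closure_minimal) auto
  then show ?thesis
    using assms by (auto simp: laplacian_def intro!: sum.neutral partial_eq_0)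
qed

lemma ex_bound_compact_support:
  fixes \<psi> :: "real^'n \<Rightarrow> real"
  assumes "continuous_on UNIV \<psi>" "compact K" "\<And>x. x \<notin> K \<Longrightarrow> \<psi> x = 0"
  obtains B where "B \<ge> 0" "\<And>x. \<bar>\<psi> x\<bar> \<le> B"
proof -
  have "bounded (\<psi> ` K)"
    using assms by (intro compact_imp_bounded compact_continuous_image) (auto intro: continuous_on_subset)
  then obtain B where B: "\<forall>x\<in>K. \<bar>\<psi> x\<bar> \<le> B" by (auto simp: bounded_iff)
  show ?thesis
  proof (rule that[of "\<bar>B\<bar>"])
    show "\<bar>\<psi> x\<bar> \<le> \<bar>B\<bar>" for x using B assms(3)[of x] by (cases "x \<in> K") force+
  qed simp
qed

lemma locally_integrable_mult:
  assumes "locally_integrable f" "continuous_on UNIV \<psi>" "compact K" "\<And>x. x \<notin> K \<Longrightarrow> \<psi> x = 0"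
  shows "integrable lebesgue (\<lambda>x. f x * \<psi> x)"
proof -
  obtain B where B: "B \<ge> 0" "\<And>x. \<bar>\<psi> x\<bar> \<le> B" using ex_bound_compact_support[OF assms(2-4)] by auto
  have i: "integrable lebesgue (\<lambda>x. indicator K x *\<^sub>R f x)"
    using assms(1,3) by (auto simp: locally_integrable_def set_integrable_def)
  have eq: "f x * \<psi> x = (indicator K x *\<^sub>R f x) * \<psi> x" for x
    using assms(4)[of x] by (auto simp: indicator_def)
  have "\<psi> \<in> borel_measurable lebesgue"
    using borel_measurable_continuous_onI[OF assms(2)] by (simp add: measurable_completion)
  then show ?thesis
    unfolding eq
    by (intro Bochner_Integration.integrable_bound[OF integrable_mult_left[OF i, of B]])
      (use i B in \<open>auto simp: abs_mult intro!: mult_left_mono borel_measurable_times always_eventually\<close>)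
qed

subsection \<open>Pairings and time-continuous families\<close>

lemma in_Lp_1_integrable: "in_Lp 1 f \<Longrightarrow> integrable lebesgue f"
  using integrable_abs_iff[of f lebesgue] by (simp add: in_Lp_def)

lemma abs_powr_mult_self: "\<bar>\<bar>y\<bar> powr (p - 1) * y\<bar> = \<bar>y\<bar> powr p" for y :: real
  by (cases "y = 0") (simp_all add: abs_mult powr_diff)

lemma in_Lp_integrable_nonlin:
  assumes "in_Lp p f"
  shows "integrable lebesgue (\<lambda>x. \<bar>f x\<bar> powr (p - 1) * f x)"
  by (rule Bochner_Integration.integrable_bound[of lebesgue "\<lambda>x. \<bar>f x\<bar> powr p"])
    (use assms abs_powr_mult_self[of _ p] in \<open>auto simp: in_Lp_def\<close>)

text \<open>A substitute for Minkowski's inequality that works for every positive exponent: the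
  larger of the two terms on the right is at least half of \<open>\<bar>x\<bar>\<close> before
  powers are taken. Only finiteness matters later, so the factor \<open>2 powr r\<close> is
  harmless.\<close>

lemma abs_powr_le_diff:
  fixes x y r :: real
  assumes "r > 0"
  shows "\<bar>x\<bar> powr r \<le> 2 powr r * (\<bar>x - y\<bar> powr r + \<bar>y\<bar> powr r)"
proof -
  define m where "m = max \<bar>x - y\<bar> \<bar>y\<bar>"
  have "\<bar>x\<bar> \<le> 2 * m" using abs_triangle_ineq[of "x - y" y]
    by (simp add: m_def max_def)
  then have "\<bar>x\<bar> powr r \<le> (2 * m) powr r" using assms by (intro powr_mono2) auto
  also have "\<dots> = 2 powr r * m powr r" by (simp add: powr_mult m_def)
  also have "m powr r \<le> \<bar>x - y\<bar> powr r + \<bar>y\<bar> powr r" by (auto simp: m_def max_def)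
  finally show ?thesis by simp
qed

lemma in_Lp_diff:
  assumes "in_Lp r f" "in_Lp r g" "r > 0"
  shows "in_Lp r (\<lambda>x. f x - g x)"
proof -
  have [measurable]: "f \<in> borel_measurable lebesgue" "g \<in> borel_measurable lebesgue"
    using assms by (auto simp: in_Lp_def)
  have "integrable lebesgue (\<lambda>x. 2 powr r * (\<bar>f x\<bar> powr r + \<bar>g x\<bar> powr r))"
    using assms by (auto simp: in_Lp_def)
  moreover have "\<bar>f x - g x\<bar> powr r \<le> 2 powr r * (\<bar>f x\<bar> powr r + \<bar>g x\<bar> powr r)" for x
    using abs_powr_le_diff[OF \<open>r > 0\<close>, of "f x - g x" "- g x"] by simp
  ultimately have "integrable lebesgue (\<lambda>x. \<bar>f x - g x\<bar> powr r)"
    using Bochner_Integration.integrable_bound[of lebesgue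
        "\<lambda>x. 2 powr r * (\<bar>f x\<bar> powr r + \<bar>g x\<bar> powr r)" "\<lambda>x. \<bar>f x - g x\<bar> powr r"] by simp
  then show ?thesis by (simp add: in_Lp_def)
qed

text \<open>Continuity bounds the integral near each time in terms of its value there, and bisection
  joins the local bounds over a compact interval. The result supplies the majorant for dominated
  convergence in time.\<close>

lemma continuous_Lp_bounded:
  assumes v: "continuous_Lp r v" and "r > 0"
  obtains B where "B \<ge> 0" "\<And>t. 0 \<le> t \<Longrightarrow> t \<le> T \<Longrightarrow> (LINT x|lebesgue. \<bar>v t x\<bar> powr r) \<le> B"
proof -
  define I where "I t = (LINT x|lebesgue. \<bar>v t x\<bar> powr r)" for t
  have vr: "in_Lp r (v t)" if "t \<ge> 0" for t
    using v that by (auto simp: continuous_Lp_def)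
  \<comment> \<open>Bisection also tests small intervals that stick out of \<open>{0..T}\<close>,
    possibly to negative times, where nothing is known of \<open>v\<close>; hence the intersection
    in the predicate.\<close>
  have "\<exists>B. \<forall>t\<in>{0..T} \<inter> {0..T}. I t \<le> B" if "0 \<le> T"
    using that
  proof (induction rule: Bolzano[where P = "\<lambda>a b. \<exists>B. \<forall>t\<in>{0..T} \<inter> {a..b}. I t \<le> B"])
    case (trans a b c)
    then obtain B B' where B: "\<forall>t\<in>{0..T} \<inter> {a..b}. I t \<le> B" "\<forall>t\<in>{0..T} \<inter> {b..c}. I t \<le> B'"
      by blast
    have "I t \<le> max B B'" if "t \<in> {0..T} \<inter> {a..c}" for t
      using B that by (cases "t \<le> b") force+
    then show ?case by blast
  next
    case s: (local s)
    have "((\<lambda>t. Lp_norm r (\<lambda>x. v t x - v s x)) \<longlongrightarrow> 0) (at s within {0..})"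
      using v s by (auto simp: continuous_Lp_def)
    then have "\<forall>\<^sub>F t in at s within {0..}. Lp_norm r (\<lambda>x. v t x - v s x) < 1"
      by (rule order_tendstoD) simp
    then obtain e where e: "e > 0"
      "\<And>t. t \<ge> 0 \<Longrightarrow> t \<noteq> s \<Longrightarrow> dist t s < e \<Longrightarrow> Lp_norm r (\<lambda>x. v t x - v s x) < 1"
      by (auto simp: eventually_at)
    have "I t \<le> 2 powr r * (1 + I s)" if t: "t \<ge> 0" "dist t s < e" for t
    proof -
      let ?D = "LINT x|lebesgue. \<bar>v t x - v s x\<bar> powr r"
      have "Lp_norm r (\<lambda>x. v t x - v s x) < 1"
        \<comment> \<open>The limit at \<open>s\<close> says nothing about \<open>t = s\<close>,
          where the norm is 0.\<close>
        using e t by (cases "t = s") (auto simp: Lp_norm_def)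
      then have "?D powr (1 / r) < 1" by (simp add: Lp_norm_def)
      moreover have "1 \<le> ?D powr (1 / r)" if "?D > 1"
        using that \<open>r > 0\<close> by (intro ge_one_powr_ge_zero) auto
      ultimately have D: "?D \<le> 1" by linarith
      have iD: "integrable lebesgue (\<lambda>x. \<bar>v t x - v s x\<bar> powr r)"
        using in_Lp_diff[OF vr vr \<open>r > 0\<close>] t s by (auto simp: in_Lp_def)
      have i: "integrable lebesgue (\<lambda>x. \<bar>v t x\<bar> powr r)" if "t \<ge> 0" for t
        using vr[OF that] by (auto simp: in_Lp_def)
      have "I t \<le> (LINT x|lebesgue. 2 powr r * (\<bar>v t x - v s x\<bar> powr r + \<bar>v s x\<bar> powr r))"
        unfolding I_def using t s iD i abs_powr_le_diff[OF \<open>r > 0\<close>]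
        by (intro integral_mono) auto
      also have "\<dots> = 2 powr r * (?D + I s)"
        unfolding I_def using iD i s by simp
      finally show ?thesis
        using D by (meson add_right_mono mult_left_mono order_trans powr_ge_zero)
    qed
    then show ?case
      using e(1) by (intro exI[of _ e] conjI allI impI exI[of _ "2 powr r * (1 + I s)"])
        (auto simp: dist_real_def)
  qed
  then obtain B where "\<And>t. 0 \<le> t \<Longrightarrow> t \<le> T \<Longrightarrow> I t \<le> B" by fastforce
  then show ?thesis
    using that[of "\<bar>B\<bar>"] order_trans[OF _ abs_ge_self[of B]] by (simp add: I_def)
qed

lemma pairing_AE_diff:
  fixes f f1 f2 \<psi> :: "real^'n \<Rightarrow> real"
  assumes "AE x in lebesgue. f x = f1 x - f2 x"
    and "f \<in> borel_measurable lebesgue" "locally_integrable f1" "locally_integrable f2"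
    and \<psi>: "continuous_on UNIV \<psi>" "compact K" "\<And>x. x \<notin> K \<Longrightarrow> \<psi> x = 0"
  shows "pairing f \<psi> = pairing f1 \<psi> - pairing f2 \<psi>"
proof -
  have i: "integrable lebesgue (\<lambda>x. f1 x * \<psi> x)" "integrable lebesgue (\<lambda>x. f2 x * \<psi> x)"
    using locally_integrable_mult[OF _ \<psi>] assms by auto
  have [measurable]: "\<psi> \<in> borel_measurable lebesgue"
    using borel_measurable_continuous_onI[OF \<psi>(1)] by (simp add: measurable_completion)
  have "pairing f \<psi> = (LINT x|lebesgue. f1 x * \<psi> x - f2 x * \<psi> x)"
    unfolding pairing_def
  proof (rule integral_cong_AE)
    show "(\<lambda>x. f x * \<psi> x) \<in> borel_measurable lebesgue" using assms(2) by measurable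
    show "(\<lambda>x. f1 x * \<psi> x - f2 x * \<psi> x) \<in> borel_measurable lebesgue"
      using i by (auto intro: borel_measurable_diff)
    show "AE x in lebesgue. f x * \<psi> x = f1 x * \<psi> x - f2 x * \<psi> x"
      using assms(1) by eventually_elim (simp add: left_diff_distrib)
  qed
  also have "\<dots> = pairing f1 \<psi> - pairing f2 \<psi>"
    unfolding pairing_def using i by simp
  finally show ?thesis .
qed

lemma pairing_le:
  fixes f \<psi> :: "real^'n \<Rightarrow> real"
  assumes f: "integrable lebesgue f" and B: "\<And>x. \<bar>\<psi> x\<bar> \<le> B"
  shows "\<bar>pairing f \<psi>\<bar> \<le> B * (LINT x|lebesgue. \<bar>f x\<bar>)"
proof -
  have B0: "0 \<le> B" using B[of 0] by linarith
  have "\<bar>pairing f \<psi>\<bar> \<le> (LINT x|lebesgue. B * \<bar>f x\<bar>)"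
    unfolding pairing_def real_norm_def[symmetric]
  proof (rule order_trans[OF integral_norm_bound integral_mono'])
    show "integrable lebesgue (\<lambda>x. B * norm (f x))" using f by simp
  qed (use B B0 in \<open>auto simp: abs_mult mult.commute intro: mult_right_mono\<close>)
  then show ?thesis by simp
qed

text \<open>The widening cutoff tends pointwise to its value at the origin, and
  \<open>B * \<bar>f x\<bar>\<close> dominates. In this way pairings recover the integral over the
  whole space.\<close>

lemma pairing_scale_tendsto:
  fixes f \<psi> :: "real^'n \<Rightarrow> real"
  assumes f: "integrable lebesgue f"
    and \<psi>: "continuous_on UNIV \<psi>" and B: "\<And>x. \<bar>\<psi> x\<bar> \<le> B"
  shows "(\<lambda>k. pairing f (\<lambda>x. \<psi> ((1 / real (Suc k)) *\<^sub>R x))) \<longlonglongrightarrow> (LINT x|lebesgue. f x) * \<psi> 0"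
proof -
  have "(\<lambda>k. LINT x|lebesgue. f x * \<psi> ((1 / real (Suc k)) *\<^sub>R x)) \<longlonglongrightarrow> (LINT x|lebesgue. f x * \<psi> 0)"
  proof (rule integral_dominated_convergence[where w = "\<lambda>x. B * \<bar>f x\<bar>"])
    have m: "(\<lambda>x. \<psi> (c *\<^sub>R x)) \<in> borel_measurable lebesgue" for c
    proof -
      have "continuous_on UNIV (\<lambda>x. \<psi> (c *\<^sub>R x))"
        using continuous_on_compose2[OF \<psi>, of UNIV "\<lambda>x. c *\<^sub>R x"] by (simp add: continuous_on_scaleR)
      from borel_measurable_continuous_onI[OF this] show ?thesis
        by (simp add: measurable_completion)
    qed
    show "(\<lambda>x. f x * \<psi> ((1 / real (Suc k)) *\<^sub>R x)) \<in> borel_measurable lebesgue" for k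
      using f m by (intro borel_measurable_times) auto
    show "(\<lambda>x. f x * \<psi> 0) \<in> borel_measurable lebesgue" using f by auto
    show "integrable lebesgue (\<lambda>x. B * \<bar>f x\<bar>)" using f by auto
    have "(\<lambda>k. \<psi> ((1 / real (Suc k)) *\<^sub>R x)) \<longlonglongrightarrow> \<psi> 0" for x
    proof (rule continuous_on_tendsto_compose[OF \<psi>])
      have "(\<lambda>k. (1 / real (Suc k)) *\<^sub>R x) \<longlonglongrightarrow> 0 *\<^sub>R x"
        by (intro tendsto_scaleR tendsto_const) (rule LIMSEQ_Suc[OF lim_1_over_n])
      then show "(\<lambda>k. (1 / real (Suc k)) *\<^sub>R x) \<longlonglongrightarrow> 0" by simp
    qed auto
    then show "AE x in lebesgue. (\<lambda>k. f x * \<psi> ((1 / real (Suc k)) *\<^sub>R x)) \<longlonglongrightarrow> f x * \<psi> 0"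
      by (intro AE_I2 tendsto_mult tendsto_const)
    show "AE x in lebesgue. norm (f x * \<psi> ((1 / real (Suc k)) *\<^sub>R x)) \<le> B * \<bar>f x\<bar>" for k
      using B by (intro AE_I2) (simp add: abs_mult mult.commute[of B] mult_left_mono)
  qed
  then show ?thesis by (simp add: pairing_def)
qed

text \<open>Variation of constants: \<open>?\<Phi> s\<close> is the value at time \<open>t\<close>
  of the homogeneous solution with data \<open>g s\<close> and \<open>d s\<close> at time
  \<open>s\<close>, so it changes only through \<open>S\<close>. The fundamental theorem yields
  integrability together with the value, without continuity of \<open>S\<close>.\<close>

lemma duhamel:
  fixes g d S :: "real \<Rightarrow> real"
  assumes "M \<noteq> 0" "t \<ge> 0"
    and g: "\<And>s. s \<ge> 0 \<Longrightarrow> (g has_real_derivative d s) (at s within {0..})"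
    and d: "\<And>s. s \<ge> 0 \<Longrightarrow> (d has_real_derivative M\<^sup>2 * g s + S s) (at s within {0..})"
  shows "((\<lambda>s. sinh (M * (t - s)) / M * S s) has_integral
    g t - (cosh (M * t) * g 0 + sinh (M * t) / M * d 0)) {0..t}"
proof -
  let ?\<Phi> = "\<lambda>s. cosh (M * (t - s)) * g s + sinh (M * (t - s)) / M * d s"
  have "(?\<Phi> has_real_derivative sinh (M * (t - s)) / M * S s) (at s within {0..t})"
    if "s \<in> {0..t}" for s
  proof -
    have g': "(g has_real_derivative d s) (at s within {0..t})"
      and d': "(d has_real_derivative M\<^sup>2 * g s + S s) (at s within {0..t})"
      using that by (auto intro: DERIV_subset[OF g] DERIV_subset[OF d])
    have "((\<lambda>s. cosh (M * (t - s))) has_real_derivative - M * sinh (M * (t - s))) (at s within {0..t})"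
      by (auto intro!: derivative_eq_intros)
    moreover have "((\<lambda>s. sinh (M * (t - s)) / M) has_real_derivative - cosh (M * (t - s)))
        (at s within {0..t})"
      using \<open>M \<noteq> 0\<close> by (auto intro!: derivative_eq_intros)
    ultimately have "(?\<Phi> has_real_derivative
        (- M * sinh (M * (t - s)) * g s + d s * cosh (M * (t - s))) +
        (- cosh (M * (t - s)) * d s + (M\<^sup>2 * g s + S s) * (sinh (M * (t - s)) / M)))
        (at s within {0..t})"
      using g' d' by (intro DERIV_add DERIV_mult)
    then show ?thesis
      by (rule DERIV_cong) (use \<open>M \<noteq> 0\<close> in \<open>simp add: field_simps power2_eq_square\<close>)
  qed
  then have "((\<lambda>s. sinh (M * (t - s)) / M * S s) has_integral ?\<Phi> t - ?\<Phi> 0) {0..t}"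
    using \<open>t \<ge> 0\<close>
    by (intro fundamental_theorem_of_calculus) (auto simp: has_real_derivative_iff_has_vector_derivative)
  then show ?thesis by simp
qed

subsection \<open>The equation for the space integral\<close>

text \<open>
  The cutoffs \<open>\<psi>(x / k)\<close> remove the Laplacian in the limit because \<open>u(t)\<close> is integrable. Working with
  the Henstock--Kurzweil integral, the fundamental theorem and dominated convergence supply the
  integrability in time of the nonlinear term without an argument for its continuity.
\<close>

lemma mean_integral_equation:
  fixes phi :: "real \<Rightarrow> real^'n \<Rightarrow> real" and phi1 :: "real^'n \<Rightarrow> real" and n p :: real
  assumes "p > 1" "mu > 0" "lam > 0" and n: "n = real CARD('n)" and M: "M = mass CARD('n) mu"
    and sol: "global_weak_solution p q mu lam phi"
    and iv: "initial_velocity phi phi1" and phi1: "integrable lebesgue phi1" and "t \<ge> 0"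
  defines "C0 \<equiv> (LINT x|lebesgue. phi 0 x)" and "C1 \<equiv> (LINT x|lebesgue. phi1 x)"
    and "I \<equiv> \<lambda>s. exp (n / 2 * s) * nonlin_integral p phi s * (1 / M * sinh (M * (t - s)))"
  shows "I integrable_on {0..t}"
    and "exp (n / 2 * t) * (LINT x|lebesgue. phi t x) =
      cosh (M * t) * C0 + sinh (M * t) / M * (n / 2 * C0 + C1) - lam * integral {0..t} I"
proof -
  have "0 < (real CARD('n))\<^sup>2 / 4 + mu\<^sup>2" using \<open>mu > 0\<close> by (intro add_nonneg_pos) auto
  then have M0: "M > 0" by (simp add: M mass_def)
  define u where "u = (\<lambda>t x. exp (n / 2 * t) * phi t x)"
  define f where
    "f = (\<lambda>t x. lam * exp (- (n * (p - 1) / 2 * t)) * (\<bar>u t x\<bar> powr (p - 1) * u t x))"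
  obtain u0 u1 w where u_Lp: "continuous_Lp 1 u" "continuous_Lp p u"
    and u0: "solves_cauchy M (\<lambda>t x. 0) (u 0) u1 u0" and w: "resolves M f w"
    and u_eq: "\<And>t. t \<ge> 0 \<Longrightarrow> AE x in lebesgue. u t x = u0 t x - w t x"
    using sol unfolding global_weak_solution_def Let_def f_def u_def n M by auto
  have int_u: "integrable lebesgue (u t)" if "t \<ge> 0" for t
    using u_Lp(1) that by (auto simp: continuous_Lp_def intro: in_Lp_1_integrable)
  have Lp_u: "in_Lp p (u t)" if "t \<ge> 0" for t
    using u_Lp(2) that by (auto simp: continuous_Lp_def)
  have int_f: "integrable lebesgue (f t)" if "t \<ge> 0" for t
    using in_Lp_integrable_nonlin[OF Lp_u[OF that]] by (simp add: f_def)
  have f_integral: "(LINT x|lebesgue. f t x) = lam * (exp (n / 2 * t) * nonlin_integral p phi t)" for t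
  proof -
    have "f t x = lam * exp (n / 2 * t) * (\<bar>phi t x\<bar> powr (p - 1) * phi t x)" for x
    proof -
      \<comment> \<open>Passing from \<open>phi\<close> to \<open>u\<close> multiplies the
        nonlinearity by \<open>exp (n * p / 2 * t)\<close>; the weight in the equation leaves
        \<open>exp (n / 2 * t)\<close> of it.\<close>
      have "exp (- (n * (p - 1) / 2 * t)) * exp (n / 2 * t) powr (p - 1) = 1"
        by (simp add: exp_powr_real field_simps flip: exp_add)
      then show ?thesis
        by (simp add: f_def u_def abs_mult powr_mult)
    qed
    then show ?thesis by (simp add: nonlin_integral_def mult.assoc)
  qed
  obtain \<psi> :: "real^'n \<Rightarrow> real" where \<psi>: "test_function \<psi>" "\<psi> 0 = 1"
    using ex_test_function .
  let ?K = "\<lambda>\<psi>. closure {x. \<psi> x \<noteq> 0}"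
  have pairing_0: "pairing (\<lambda>x. 0) \<eta> = 0" for \<eta> :: "real^'n \<Rightarrow> real"
    by (simp add: pairing_def)
  have supp: "\<psi> x = 0" if "x \<notin> ?K \<psi>" for x and \<psi> :: "real^'n \<Rightarrow> real"
    using that closure_subset[of "{x. \<psi> x \<noteq> 0}"] by blast
  have compact_K: "compact (?K \<psi>)" if "test_function \<psi>" for \<psi> :: "real^'n \<Rightarrow> real"
    using that by (simp add: test_function_def)
  obtain B1 where B1: "B1 \<ge> 0" "\<And>x. \<bar>\<psi> x\<bar> \<le> B1"
    using ex_bound_compact_support[OF test_function_differentiable(3)[OF \<psi>(1)] compact_K[OF \<psi>(1)]] supp
    by blast
  obtain B2 where B2: "B2 \<ge> 0" "\<And>x. \<bar>laplacian \<psi> x\<bar> \<le> B2"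
    using ex_bound_compact_support[OF test_function_differentiable(4)[OF \<psi>(1)] compact_K[OF \<psi>(1)]]
      laplacian_eq_0 by blast
  obtain Bu where Bu: "Bu \<ge> 0" "\<And>s. 0 \<le> s \<Longrightarrow> s \<le> t \<Longrightarrow> (LINT x|lebesgue. \<bar>u s x\<bar> powr 1) \<le> Bu"
    using continuous_Lp_bounded[OF u_Lp(1)] by auto
  obtain Bp where Bp: "Bp \<ge> 0" "\<And>s. 0 \<le> s \<Longrightarrow> s \<le> t \<Longrightarrow> (LINT x|lebesgue. \<bar>u s x\<bar> powr p) \<le> Bp"
    using continuous_Lp_bounded[OF u_Lp(2)] \<open>p > 1\<close> by auto
  define \<psi>k where "\<psi>k k x = \<psi> ((1 / real (Suc k)) *\<^sub>R x)" for k x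
  have \<psi>k: "test_function (\<psi>k k)" for k
    unfolding \<psi>k_def[abs_def] by (rule test_function_scale(1)[OF \<psi>(1)]) simp
  have lap_\<psi>k: "laplacian (\<psi>k k) x = (1 / real (Suc k))\<^sup>2 * laplacian \<psi> ((1 / real (Suc k)) *\<^sub>R x)" for k x
    unfolding \<psi>k_def[abs_def] by (rule test_function_scale(2)[OF \<psi>(1)]) simp
  have lap_bound: "\<bar>laplacian (\<psi>k k) x\<bar> \<le> B2" for k x
  proof -
    have "(1 / real (Suc k))\<^sup>2 \<le> 1" by (simp add: power_le_one)
    then have "(1 / real (Suc k))\<^sup>2 * \<bar>laplacian \<psi> ((1 / real (Suc k)) *\<^sub>R x)\<bar> \<le> 1 * B2"
      using B2 by (intro mult_mono) auto
    then show ?thesis by (simp add: lap_\<psi>k abs_mult)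
  qed
  \<comment> \<open>The source in the scalar equation for the pairing of \<open>u\<close> with the
    cutoff; its nonlinear part carries a minus sign because \<open>u\<close> is \<open>u0\<close>
    minus \<open>w\<close>.\<close>
  define S where
    "S k s = exp (- 2 * s) * pairing (u s) (laplacian (\<psi>k k)) - pairing (f s) (\<psi>k k)" for k s
  have Duhamel: "((\<lambda>s. sinh (M * (t - s)) / M * S k s) has_integral
      pairing (u t) (\<psi>k k) - (cosh (M * t) * pairing (u 0) (\<psi>k k) +
        sinh (M * t) / M * (n / 2 * pairing (phi 0) (\<psi>k k) + pairing phi1 (\<psi>k k)))) {0..t}" for k
  proof -
    obtain d0 where d0: "\<And>t. t \<ge> 0 \<Longrightarrow>
        ((\<lambda>s. pairing (u0 s) (\<psi>k k)) has_real_derivative d0 t) (at t within {0..})"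
      "\<And>t. t \<ge> 0 \<Longrightarrow> (d0 has_real_derivative
        exp (- 2 * t) * pairing (u0 t) (laplacian (\<psi>k k)) + M\<^sup>2 * pairing (u0 t) (\<psi>k k))
        (at t within {0..})"
      using u0 \<psi>k[of k] unfolding solves_cauchy_def pairing_0 add_0_right by blast
    obtain d1 where d1: "\<And>t. t \<ge> 0 \<Longrightarrow>
        ((\<lambda>s. pairing (w s) (\<psi>k k)) has_real_derivative d1 t) (at t within {0..})"
      "\<And>t. t \<ge> 0 \<Longrightarrow> (d1 has_real_derivative
        exp (- 2 * t) * pairing (w t) (laplacian (\<psi>k k)) + M\<^sup>2 * pairing (w t) (\<psi>k k) +
          pairing (f t) (\<psi>k k)) (at t within {0..})"
      using w \<psi>k[of k] unfolding resolves_def solves_cauchy_def by blast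
    have li: "locally_integrable (u0 t)" "locally_integrable (w t)" if "t \<ge> 0" for t
      using u0 w that by (auto simp: resolves_def solves_cauchy_def)
    have pd: "pairing (u t) \<eta> = pairing (u0 t) \<eta> - pairing (w t) \<eta>"
      if "t \<ge> 0" "\<eta> = \<psi>k k \<or> \<eta> = laplacian (\<psi>k k)" for t \<eta>
    proof (rule pairing_AE_diff[where K = "?K (\<psi>k k)"])
      show "u t \<in> borel_measurable lebesgue" using int_u that by auto
      show "continuous_on UNIV \<eta>"
        using that(2) test_function_differentiable[OF \<psi>k] by auto
      show "\<eta> x = 0" if "x \<notin> ?K (\<psi>k k)" for x
        using supp[OF that] laplacian_eq_0[OF that] \<open>\<eta> = \<psi>k k \<or> \<eta> = laplacian (\<psi>k k)\<close> by auto
    qed (use that u_eq li compact_K[OF \<psi>k] in auto)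
    let ?g = "\<lambda>s. pairing (u0 s) (\<psi>k k) - pairing (w s) (\<psi>k k)" and ?d = "\<lambda>s. d0 s - d1 s"
    have g: "(?g has_real_derivative ?d s) (at s within {0..})" if "s \<ge> 0" for s
      using d0(1) d1(1) that by (intro DERIV_diff) auto
    have d: "(?d has_real_derivative M\<^sup>2 * ?g s + S k s) (at s within {0..})" if "s \<ge> 0" for s
      by (rule DERIV_cong[OF DERIV_diff[OF d0(2) d1(2)]])
        (use that in \<open>simp_all add: S_def pd algebra_simps\<close>)
    \<comment> \<open>The initial slope \<open>?d 0\<close> is expressed by \<open>phi1\<close>: the
      product rule for \<open>exp (n / 2 * s)\<close> times \<open>phi\<close> gives a one-sided
      derivative at 0, and such a derivative is unique.\<close>
    have "((\<lambda>s. pairing (phi s) (\<psi>k k)) has_real_derivative pairing phi1 (\<psi>k k)) (at 0 within {0..})"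
      using iv \<psi>k by (auto simp: initial_velocity_def)
    moreover have "((\<lambda>s. exp (n / 2 * s)) has_real_derivative n / 2) (at 0 within {0..})"
      by (auto intro!: derivative_eq_intros)
    ultimately have "((\<lambda>s. exp (n / 2 * s) * pairing (phi s) (\<psi>k k)) has_real_derivative
        n / 2 * pairing (phi 0) (\<psi>k k) + pairing phi1 (\<psi>k k) * exp (n / 2 * 0)) (at 0 within {0..})"
      by (intro DERIV_mult)
    moreover have "exp (n / 2 * s) * pairing (phi s) (\<psi>k k) = ?g s" if "s \<ge> 0" for s
    proof -
      have "exp (n / 2 * s) * pairing (phi s) (\<psi>k k) = pairing (u s) (\<psi>k k)"
        by (simp add: pairing_def u_def mult.assoc)
      then show ?thesis using pd that by simp
    qed
    ultimately have "(?g has_real_derivative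
        n / 2 * pairing (phi 0) (\<psi>k k) + pairing phi1 (\<psi>k k)) (at 0 within {0..})"
      using has_field_derivative_transform_within[of _ _ 0 "{0..}" 1 ?g] by simp
    then have d_0: "?d 0 = n / 2 * pairing (phi 0) (\<psi>k k) + pairing phi1 (\<psi>k k)"
      using g[of 0] vector_derivative_unique_within[of 0 "{0..}" ?g]
      by (simp add: at_within_Ici_at_right has_real_derivative_iff_has_vector_derivative)
    show ?thesis
      using duhamel[OF less_imp_neq[OF M0, symmetric] \<open>t \<ge> 0\<close> g d] d_0 pd \<open>t \<ge> 0\<close> by simp
  qed
  let ?S = "\<lambda>s. - (lam * (exp (n / 2 * s) * nonlin_integral p phi s))"
  \<comment> \<open>The Laplacian term is a null sequence times a convergent pairing. As the cutoff
    equals 1 at the origin, the nonlinear term tends to its full space integral.\<close>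
  have S_lim: "(\<lambda>k. S k s) \<longlonglongrightarrow> ?S s" if s: "s \<ge> 0" for s
  proof -
    have c: "(\<lambda>k. 1 / real (Suc k)) \<longlonglongrightarrow> 0" by (rule LIMSEQ_Suc[OF lim_1_over_n])
    have "(\<lambda>k. (1 / real (Suc k))\<^sup>2 * pairing (u s) (\<lambda>x. laplacian \<psi> ((1 / real (Suc k)) *\<^sub>R x)))
        \<longlonglongrightarrow> 0\<^sup>2 * ((LINT x|lebesgue. u s x) * laplacian \<psi> 0)"
      by (intro tendsto_mult tendsto_power c pairing_scale_tendsto[OF int_u[OF s]
          test_function_differentiable(4)[OF \<psi>(1)] B2(2)])
    moreover have "pairing (u s) (laplacian (\<psi>k k)) =
        (1 / real (Suc k))\<^sup>2 * pairing (u s) (\<lambda>x. laplacian \<psi> ((1 / real (Suc k)) *\<^sub>R x))" for k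
    proof -
      have "pairing (u s) (laplacian (\<psi>k k)) = (LINT x|lebesgue.
          (1 / real (Suc k))\<^sup>2 * (u s x * laplacian \<psi> ((1 / real (Suc k)) *\<^sub>R x)))"
        unfolding pairing_def lap_\<psi>k by (rule Bochner_Integration.integral_cong) (simp_all only: ac_simps)
      then show ?thesis unfolding pairing_def by simp
    qed
    ultimately have 1: "(\<lambda>k. pairing (u s) (laplacian (\<psi>k k))) \<longlonglongrightarrow> 0" by simp
    have 2: "(\<lambda>k. pairing (f s) (\<psi>k k)) \<longlonglongrightarrow> (LINT x|lebesgue. f s x) * \<psi> 0"
      unfolding \<psi>k_def[abs_def]
      by (rule pairing_scale_tendsto[OF int_f[OF s] test_function_differentiable(3)[OF \<psi>(1)] B1(2)])
    have "(\<lambda>k. S k s) \<longlonglongrightarrow> exp (- 2 * s) * 0 - (LINT x|lebesgue. f s x) * \<psi> 0"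
      unfolding S_def by (intro tendsto_diff tendsto_mult tendsto_const 1 2)
    then show ?thesis by (simp add: f_integral \<psi>(2))
  qed
  \<comment> \<open>The bound is uniform in \<open>k\<close> and \<open>s\<close>: both decaying
    exponentials are at most 1, and the integrals of \<open>\<bar>u\<bar>\<close> and
    \<open>\<bar>u\<bar> powr p\<close> are bounded on \<open>{0..t}\<close>.\<close>
  have S_bound: "\<bar>S k s\<bar> \<le> B2 * Bu + B1 * (lam * Bp)" if s: "s \<in> {0..t}" for k s
  proof -
    have "\<bar>pairing (u s) (laplacian (\<psi>k k))\<bar> \<le> B2 * (LINT x|lebesgue. \<bar>u s x\<bar>)"
      using s by (intro pairing_le int_u lap_bound) auto
    also have "\<dots> \<le> B2 * Bu" using Bu(2)[of s] s B2(1) by (intro mult_left_mono) auto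
    finally have "\<bar>pairing (u s) (laplacian (\<psi>k k))\<bar> \<le> B2 * Bu" .
    moreover have "exp (- 2 * s) \<le> 1" using s by simp
    ultimately have 1: "\<bar>exp (- 2 * s) * pairing (u s) (laplacian (\<psi>k k))\<bar> \<le> 1 * (B2 * Bu)"
      unfolding abs_mult by (intro mult_mono) auto
    have "\<bar>pairing (f s) (\<psi>k k)\<bar> \<le> B1 * (LINT x|lebesgue. \<bar>f s x\<bar>)"
      using s B1 by (intro pairing_le int_f) (auto simp: \<psi>k_def)
    also have "(LINT x|lebesgue. \<bar>f s x\<bar>) \<le> (LINT x|lebesgue. lam * \<bar>u s x\<bar> powr p)"
    proof (rule integral_mono)
      show "integrable lebesgue (\<lambda>x. \<bar>f s x\<bar>)" using int_f s by auto
      show "integrable lebesgue (\<lambda>x. lam * \<bar>u s x\<bar> powr p)" using Lp_u s by (auto simp: in_Lp_def)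
      show "\<bar>f s x\<bar> \<le> lam * \<bar>u s x\<bar> powr p" for x
      proof -
        have "0 \<le> n * (p - 1) / 2 * s" using s \<open>p > 1\<close> by (simp add: n)
        then have "exp (- (n * (p - 1) / 2 * s)) \<le> 1" by simp
        then have "lam * exp (- (n * (p - 1) / 2 * s)) * \<bar>u s x\<bar> powr p \<le> lam * 1 * \<bar>u s x\<bar> powr p"
          using \<open>lam > 0\<close> by (intro mult_right_mono mult_left_mono) auto
        then show ?thesis
          using \<open>lam > 0\<close> abs_powr_mult_self[of "u s x" p] by (simp add: f_def abs_mult)
      qed
    qed
    also have "\<dots> \<le> lam * Bp" using Bp(2)[of s] s \<open>lam > 0\<close> by simp
    finally have "\<bar>pairing (f s) (\<psi>k k)\<bar> \<le> B1 * (lam * Bp)" using B1(1) by (simp add: mult_left_mono)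
    with 1 show ?thesis unfolding S_def by linarith
  qed
  have bound: "norm (sinh (M * (t - s)) / M * S k s) \<le>
      sinh (M * t) / M * (B2 * Bu + B1 * (lam * Bp))" if s: "s \<in> {0..t}" for k s
  proof -
    have "0 \<le> sinh (M * (t - s)) / M" using s M0 by simp
    moreover have "sinh (M * (t - s)) / M \<le> sinh (M * t) / M"
      using s M0 by (intro divide_right_mono) (auto intro!: mult_left_mono)
    ultimately show ?thesis
      using S_bound[OF s, of k] unfolding real_norm_def abs_mult by (intro mult_mono) auto
  qed
  let ?J = "\<lambda>s. sinh (M * (t - s)) / M * ?S s"
  have conv: "(\<lambda>k. sinh (M * (t - s)) / M * S k s) \<longlonglongrightarrow> ?J s" if "s \<in> {0..t}" for s
    using that by (intro tendsto_mult tendsto_const S_lim) auto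
  \<comment> \<open>The majorant is constant in \<open>s\<close>. The two conclusions are
    integrability of the limit and convergence of the integrals.\<close>
  note dominated = dominated_convergence[OF has_integral_integrable[OF Duhamel] integrable_const_ivl
      bound conv]
  note J = dominated(1) and J_lim = dominated(2)
  have J_eq: "?J = (\<lambda>s. - lam * I s)" by (auto simp: I_def)
  have "(\<lambda>s. (- 1 / lam) * (- lam * I s)) integrable_on {0..t}"
    using J unfolding J_eq by (rule integrable_on_mult_right)
  then show "I integrable_on {0..t}" using \<open>lam > 0\<close> by simp
  have pairing_lim: "(\<lambda>k. pairing h (\<psi>k k)) \<longlonglongrightarrow> (LINT x|lebesgue. h x)"
    if "integrable lebesgue h" for h
    using pairing_scale_tendsto[OF that test_function_differentiable(3)[OF \<psi>(1)] B1(2)] \<psi>(2)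
    by (simp add: \<psi>k_def[abs_def])
  have phi0: "phi 0 = u 0" by (simp add: u_def)
  have "(\<lambda>k. pairing (u t) (\<psi>k k) - (cosh (M * t) * pairing (u 0) (\<psi>k k) +
        sinh (M * t) / M * (n / 2 * pairing (phi 0) (\<psi>k k) + pairing phi1 (\<psi>k k))))
      \<longlonglongrightarrow> (LINT x|lebesgue. u t x) - (cosh (M * t) * C0 + sinh (M * t) / M * (n / 2 * C0 + C1))"
    unfolding C0_def C1_def phi0
    by (intro tendsto_intros pairing_lim int_u phi1 \<open>t \<ge> 0\<close>) simp_all
  then have "(LINT x|lebesgue. u t x) - (cosh (M * t) * C0 + sinh (M * t) / M * (n / 2 * C0 + C1)) =
      integral {0..t} ?J"
    using J_lim unfolding integral_unique[OF Duhamel] by (rule LIMSEQ_unique)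
  also have "\<dots> = - lam * integral {0..t} I" unfolding J_eq by simp
  finally show "exp (n / 2 * t) * (LINT x|lebesgue. phi t x) =
      cosh (M * t) * C0 + sinh (M * t) / M * (n / 2 * C0 + C1) - lam * integral {0..t} I"
    by (simp add: u_def)
qed

subsection \<open>Blow-up\<close>

text \<open>
  In terms of \<open>V t = exp (- M t) * W t\<close> a lower bound \<open>L\<close> on \<open>[\<tau>, \<infinity>)\<close> improves to
  \<open>k L\<^sup>p h (1 - exp (- M h))\<close> on \<open>[\<tau> + h, \<infinity>)\<close>. One long step makes the bound large, and the steps
  \<open>h = 2\<^sup>-\<^sup>j\<close> then drive it to infinity before time \<open>\<tau> + 2\<close>.
\<close>

lemma blow_up:
  fixes W K :: "real \<Rightarrow> real"
  assumes "p > 1" "M > 0" "lam > 0" "\<kappa> > 0" "c > 0"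
    and int: "\<And>t. t \<ge> T \<Longrightarrow> (\<lambda>s. sinh (M * (t - s)) / M * K s) integrable_on {T..t}"
    and K: "\<And>s. s \<ge> T \<Longrightarrow> \<kappa> * (exp (- ((p - 1) * M * s)) * W s powr p) \<le> K s"
    and W: "\<And>t. t \<ge> T \<Longrightarrow>
      c * exp (M * t) + lam * integral {T..t} (\<lambda>s. sinh (M * (t - s)) / M * K s) \<le> W t"
  shows False
proof -
  define V where "V t = exp (- M * t) * W t" for t
  \<comment> \<open>One factor 1/2 comes from the definition of \<open>sinh\<close>, the other from
    integrating over only half of a step.\<close>
  define k where "k = lam * \<kappa> / (4 * M)"
  have k: "k > 0" using assms by (simp add: k_def)
  have K0: "0 \<le> K s" if "s \<ge> T" for s
    by (rule order_trans[OF _ K[OF that]]) (use assms in simp)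
  have nonneg: "0 \<le> sinh (M * (t - s)) / M * K s" if "s \<in> {T..t}" for s t
    using that K0[of s] \<open>M > 0\<close> by simp
  have V0: "c \<le> V t" if "t \<ge> T" for t
  proof -
    have "0 \<le> integral {T..t} (\<lambda>s. sinh (M * (t - s)) / M * K s)"
      using nonneg by (intro Henstock_Kurzweil_Integration.integral_nonneg int that) auto
    then have "0 \<le> lam * integral {T..t} (\<lambda>s. sinh (M * (t - s)) / M * K s)"
      using \<open>lam > 0\<close> by (intro mult_nonneg_nonneg) auto
    then have "c * exp (M * t) \<le> W t" using W[OF that] by linarith
    then have "exp (- M * t) * (c * exp (M * t)) \<le> V t"
      unfolding V_def by (intro mult_left_mono) auto
    then show ?thesis by (simp add: exp_minus field_simps)
  qed
  have step: "k * L powr p * (h * (1 - exp (- M * h))) \<le> V t"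
    if L: "L > 0" and \<tau>: "\<tau> \<ge> T" and h: "h > 0" and V: "\<And>s. s \<ge> \<tau> \<Longrightarrow> L \<le> V s"
      and t: "t \<ge> \<tau> + h" for L \<tau> h t
  proof -
    \<comment> \<open>On the first half of the step \<open>t - s\<close> is at least
      \<open>h / 2\<close>, which keeps \<open>sinh (M * (t - s))\<close> away from zero.\<close>
    let ?J = "{\<tau>..\<tau> + h / 2}"
    let ?m = "\<kappa> * L powr p * exp (M * t) * (1 - exp (- M * h)) / (2 * M)"
    have lower: "?m \<le> sinh (M * (t - s)) / M * K s" if s: "s \<in> ?J" for s
    proof -
      have Ws: "W s = exp (M * s) * V s" by (simp add: V_def exp_minus)
      have "L powr p \<le> V s powr p" using V[of s] L s \<open>p > 1\<close> by (intro powr_mono2) auto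
      moreover have "W s powr p = exp (M * s * p) * V s powr p"
        unfolding Ws using V[of s] L s by (simp add: powr_mult exp_powr_real)
      \<comment> \<open>The weight in the hypothesis on \<open>K\<close> leaves exactly
        \<open>exp (M * s)\<close>, which below completes \<open>exp (M * (t - s))\<close> to
        \<open>exp (M * t)\<close> and so makes the estimate for \<open>V\<close> independent of
        \<open>t\<close>.\<close>
      moreover have "exp (- ((p - 1) * M * s)) * exp (M * s * p) = exp (M * s)"
        by (simp add: algebra_simps flip: exp_add)
      ultimately have "exp (M * s) * L powr p \<le> exp (- ((p - 1) * M * s)) * W s powr p"
        by (simp flip: mult.assoc)
      then have "\<kappa> * (exp (M * s) * L powr p) \<le> \<kappa> * (exp (- ((p - 1) * M * s)) * W s powr p)"
        using \<open>\<kappa> > 0\<close> by (intro mult_left_mono) auto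
      also have "\<dots> \<le> K s" using K[of s] s \<tau> by simp
      finally have Ks: "\<kappa> * (exp (M * s) * L powr p) \<le> K s" .
      have "M * (h / 2) \<le> M * (t - s)" using s t \<open>M > 0\<close> by (intro mult_left_mono) auto
      then have "exp (- (2 * (M * (t - s)))) \<le> exp (- M * h)" by simp
      then have "exp (M * t) * (1 - exp (- M * h)) \<le> exp (M * t) * (1 - exp (- (2 * (M * (t - s)))))"
        by (intro mult_left_mono) auto
      also have "\<dots> = 2 * sinh (M * (t - s)) * exp (M * s)"
        by (simp add: sinh_field_def algebra_simps flip: exp_add)
      finally have "(exp (M * t) * (1 - exp (- M * h))) * (\<kappa> * L powr p / (2 * M)) \<le>
          (2 * sinh (M * (t - s)) * exp (M * s)) * (\<kappa> * L powr p / (2 * M))"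
        using assms by (intro mult_right_mono) auto
      then have "?m \<le> sinh (M * (t - s)) / M * (\<kappa> * (exp (M * s) * L powr p))"
        by (simp add: ac_simps)
      also have "\<dots> \<le> sinh (M * (t - s)) / M * K s"
        using s t h \<open>M > 0\<close> by (intro mult_left_mono Ks) auto
      finally show ?thesis .
    qed
    have sub: "?J \<subseteq> {T..t}" using \<tau> t h by auto
    have tT: "t \<ge> T" using \<tau> t h by auto
    have intJ: "(\<lambda>s. sinh (M * (t - s)) / M * K s) integrable_on ?J"
      using integrable_on_subinterval[OF int[OF tT] sub] .
    have "?m * (h / 2) = integral ?J (\<lambda>s. ?m)" using h by simp
    also have "\<dots> \<le> integral ?J (\<lambda>s. sinh (M * (t - s)) / M * K s)"
      by (intro integral_le intJ integrable_const_ivl lower)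
    also have "\<dots> \<le> integral {T..t} (\<lambda>s. sinh (M * (t - s)) / M * K s)"
      using nonneg by (intro integral_subset_le sub intJ int tT ballI)
    finally have "lam * (?m * (h / 2)) \<le> lam * integral {T..t} (\<lambda>s. sinh (M * (t - s)) / M * K s)"
      using \<open>lam > 0\<close> by (intro mult_left_mono) auto
    also have "\<dots> \<le> W t"
      using W[OF tT] mult_pos_pos[OF \<open>c > 0\<close> exp_gt_zero[of "M * t"]] by linarith
    finally have "exp (- M * t) * (lam * (?m * (h / 2))) \<le> V t"
      unfolding V_def by (intro mult_left_mono) auto
    moreover have "exp (- M * t) * (lam * (?m * (h / 2))) = k * L powr p * (h * (1 - exp (- M * h)))"
      using exp_minus_inverse[of "M * t"] \<open>M > 0\<close> by (simp add: k_def ac_simps)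
    ultimately show ?thesis by simp
  qed
  \<comment> \<open>A step of length \<open>2^-j\<close> gains only a multiple of
    \<open>4^-j\<close>; with \<open>\<theta> powr (p - 1) = 4\<close> the power of the bound
    \<open>\<Lambda> * \<theta> ^ j\<close> compensates this loss.\<close>
  define \<theta> where "\<theta> = 4 powr (1 / (p - 1))"
  have \<theta>: "\<theta> > 1" "\<theta> powr (p - 1) = 4"
    using \<open>p > 1\<close> by (auto simp: \<theta>_def powr_powr intro!: gr_one_powr)
  \<comment> \<open>A slope for the linear lower bound of \<open>1 - exp (- M * h)\<close> on
    \<open>0 < h \<le> 1\<close>, by the mean value estimate with the smallest derivative.\<close>
  define m where "m = M * exp (- M)"
  have m: "m > 0" using assms by (simp add: m_def)
  have one_minus_exp: "m * h \<le> 1 - exp (- M * h)" if "0 < h" "h \<le> 1" for h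
  proof -
    have "M * h \<le> exp (M * h) - 1" using exp_ge_add_one_self[of "M * h"] by linarith
    then have "exp (- M * h) * (M * h) \<le> exp (- M * h) * (exp (M * h) - 1)"
      by (intro mult_left_mono) auto
    also have "\<dots> = 1 - exp (- M * h)" by (simp add: algebra_simps exp_minus)
    finally have *: "exp (- M * h) * (M * h) \<le> 1 - exp (- M * h)" .
    have "exp (- M) \<le> exp (- M * h)" using that \<open>M > 0\<close> by simp
    then have "exp (- M) * (M * h) \<le> exp (- M * h) * (M * h)"
      using that \<open>M > 0\<close> by (intro mult_right_mono) auto
    with * show ?thesis by (simp add: m_def ac_simps)
  qed
  \<comment> \<open>The level at which the gain and the loss of a step combine to a factor of
    exactly \<open>\<theta>\<close>.\<close>
  define \<Lambda> where "\<Lambda> = (\<theta> / (k * m)) powr (1 / (p - 1))"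
  have \<Lambda>: "\<Lambda> > 0" "k * m * \<Lambda> powr (p - 1) = \<theta>"
    using \<open>p > 1\<close> \<theta> k m by (auto simp: \<Lambda>_def powr_powr)
  \<comment> \<open>\<open>h * (1 - exp (- M * h))\<close> is unbounded, so a single step of some
    length \<open>H\<close> lifts the bound from \<open>c\<close> to
    \<open>\<Lambda>\<close>.\<close>
  have "filterlim (\<lambda>h. k * c powr p * (h * (1 - exp (- M * h)))) at_top at_top"
    using k \<open>c > 0\<close> \<open>M > 0\<close>
    by (intro filterlim_tendsto_pos_mult_at_top[OF tendsto_const]) (simp, real_asymp)
  then have "\<forall>\<^sub>F h in at_top. \<Lambda> \<le> k * c powr p * (h * (1 - exp (- M * h)))"
    by (simp add: filterlim_at_top)
  then obtain H where H: "H > 0" "\<Lambda> \<le> k * c powr p * (H * (1 - exp (- M * H)))"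
    using eventually_happens'[OF trivial_limit_at_top_linorder eventually_conj[OF eventually_gt_at_top[of 0]]]
    by auto
  \<comment> \<open>The starting time is \<open>T + H\<close> plus the first \<open>j\<close> step
    lengths \<open>1 + 1/2 + ...\<close>; it stays below \<open>T + H + 2\<close>, so all these
    bounds hold at that one time.\<close>
  have grow: "\<Lambda> * \<theta> ^ j \<le> V t" if "t \<ge> T + H + 2 - 2 * (1 / 2) ^ j" for j t
    using that
  proof (induction j arbitrary: t)
    case 0
    then show ?case using step[of c T H t] H V0 \<open>c > 0\<close> by force
  next
    case (Suc j)
    let ?h = "(1 / 2) ^ j :: real"
    let ?L = "\<Lambda> * \<theta> ^ j"
    have h: "0 < ?h" "?h \<le> 1" by (auto simp: power_le_one)
    have "k * ?L powr p * (?h * (m * ?h)) \<le> k * ?L powr p * (?h * (1 - exp (- M * ?h)))"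
      using one_minus_exp[OF h] k h by (intro mult_left_mono) auto
    also have "\<dots> \<le> V t"
      using Suc h H \<Lambda> \<theta> by (intro step[of _ "T + H + 2 - 2 * ?h"]) auto
    finally have *: "k * ?L powr p * (?h * (m * ?h)) \<le> V t" .
    have "?L powr p = ?L * ?L powr (p - 1)"
      using \<Lambda> \<theta> powr_add[of ?L 1 "p - 1"] by simp
    also have "?L powr (p - 1) = \<Lambda> powr (p - 1) * 4 ^ j"
    proof -
      have "(\<theta> ^ j) powr (p - 1) = (\<theta> powr (p - 1)) ^ j"
        using \<theta> by (induction j) (simp_all add: powr_mult)
      then show ?thesis using \<Lambda> \<theta> by (simp add: powr_mult)
    qed
    finally have "k * ?L powr p * (?h * (m * ?h)) = (k * m * \<Lambda> powr (p - 1)) * ?L * (4 ^ j * (?h * ?h))"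
      by (simp add: ac_simps)
    also have "4 ^ j * (?h * ?h) = 1"
      by (simp flip: power_mult_distrib)
    finally have "k * ?L powr p * (?h * (m * ?h)) = \<Lambda> * \<theta> ^ Suc j"
      unfolding \<Lambda>(2) by simp
    with * show ?case by simp
  qed
  obtain j where "V (T + H + 2) / \<Lambda> < \<theta> ^ j"
    using real_arch_pow[OF \<theta>(1)] by blast
  then have "V (T + H + 2) < \<Lambda> * \<theta> ^ j"
    using \<Lambda>(1) by (simp add: field_simps)
  moreover have "\<Lambda> * \<theta> ^ j \<le> V (T + H + 2)"
    by (rule grow) simp
  ultimately show False by simp
qed

section \<open>Reduction to the blow-up argument\<close>

theorem corollary1p4:
  fixes phi :: "real \<Rightarrow> real^'n \<Rightarrow> real" and phi1 :: "real^'n \<Rightarrow> real"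
    and p q mu lam \<sigma> n M C0 C1 a b :: real
  assumes "p > 1" and "mu > 0" and "lam > 0" and "\<sigma> \<in> {1, -1}" and "2 \<le> q"
    and "n = real CARD('n)" and "M = mass CARD('n) mu"
    and "continuous_Lp q phi"
    and "global_weak_solution p q mu lam phi"
    and "initial_velocity phi phi1" and "integrable lebesgue phi1"
    and "C0 = (LINT x|lebesgue. phi 0 x)" and "C1 = (LINT x|lebesgue. phi1 x)"
    and "\<sigma> * ((M + n / 2) * C0 + C1) > 0"
    and "sign_condition_outside_small_nbhd (\<sigma> * ((M + n / 2) * C0 + C1) / M) p mu lam \<sigma> phi"
    and "a < (p - 1) * (M - n / 2) \<or> a = (p - 1) * (M - n / 2) \<and> b < -2"
  shows "\<not> asymptotically_weighted \<sigma> p (\<lambda>t. exp (a * t) * t powr b) phi"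
proof
  assume "asymptotically_weighted \<sigma> p (\<lambda>t. exp (a * t) * t powr b) phi"
  then obtain C where C: "C \<ge> 0" "\<forall>\<^sub>F t in at_top. \<bar>LINT x|lebesgue. phi t x\<bar> powr p
      \<le> - \<sigma> * C * (exp (a * t) * t powr b) * nonlin_integral p phi t"
    by (auto simp: asymptotically_weighted_def)
  note n = \<open>n = real CARD('n)\<close> and M = \<open>M = mass CARD('n) mu\<close>
  define A where "A = \<sigma> * ((M + n / 2) * C0 + C1) / M"
  obtain \<delta> \<epsilon> where \<delta>: "\<delta> > 0" and \<epsilon>: "\<epsilon> < A"
    and sign: "\<And>t. t \<ge> \<delta> \<Longrightarrow> \<sigma> * nonlin_integral p phi t \<le> 0"
    and small: "\<forall>\<^sub>F t in at_top. lam * \<bar>integral {0..\<delta>}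
        (\<lambda>b. exp (n / 2 * b) * nonlin_integral p phi b * (1 / M * sinh (M * (t - b))))\<bar>
        \<le> \<epsilon> * cosh (M * t)"
    using assms(15)
    unfolding sign_condition_outside_small_nbhd_def sign_condition_outside_def Let_def A_def n M
    by blast
  have "0 < n\<^sup>2 / 4 + mu\<^sup>2" using \<open>mu > 0\<close> by (intro add_nonneg_pos) auto
  then have M0: "M > 0" by (simp add: M mass_def n)
  define I where
    "I t s = exp (n / 2 * s) * nonlin_integral p phi s * (1 / M * sinh (M * (t - s)))" for t s
  define K where "K s = exp (n / 2 * s) * (- \<sigma> * nonlin_integral p phi s)" for s
  define W where "W t = \<sigma> * (exp (n / 2 * t) * (LINT x|lebesgue. phi t x))" for t
  \<comment> \<open>Coefficient of the decaying mode: the homogeneous part is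
    \<open>A * cosh (M * t) - D * (cosh (M * t) - sinh (M * t))\<close>, and the last bracket is
    \<open>exp (- M * t)\<close>.\<close>
  define D where "D = \<sigma> * (C1 + n / 2 * C0) / M"
  have I_K: "sinh (M * (t - s)) / M * K s = - \<sigma> * I t s" for t s
    by (simp add: I_def K_def)
  have I_int: "I t integrable_on {0..t}" if "t \<ge> 0" for t
    unfolding I_def[abs_def]
    by (rule mean_integral_equation(1)[OF assms(1-3) n M assms(9-11) that])
  have W_eq: "W t = A * cosh (M * t) - D * exp (- M * t) - \<sigma> * (lam * integral {0..t} (I t))"
    if "t \<ge> 0" for t
  proof -
    have "W t = \<sigma> * (cosh (M * t) * C0 + sinh (M * t) / M * (n / 2 * C0 + C1) -
        lam * integral {0..t} (I t))"
      unfolding W_def I_def[abs_def] \<open>C0 = _\<close> \<open>C1 = _\<close>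
      by (subst mean_integral_equation(2)[OF assms(1-3) n M assms(9-11) that]) (rule refl)
    moreover have "\<sigma> * (cosh (M * t) * C0 + sinh (M * t) / M * (n / 2 * C0 + C1)) =
        A * cosh (M * t) - D * (cosh (M * t) - sinh (M * t))"
      using M0 by (simp add: A_def D_def field_simps)
    ultimately show ?thesis
      by (simp add: right_diff_distrib cosh_minus_sinh)
  qed
  \<comment> \<open>Below the critical exponent the exponential gap absorbs \<open>t powr b\<close>;
    at the critical exponent \<open>b\<close> is negative and the power is at most 1 for
    \<open>t \<ge> 1\<close>.\<close>
  have weight: "\<forall>\<^sub>F t in at_top. exp (a * t) * t powr b \<le> exp ((p - 1) * (M - n / 2) * t)"
    using assms(16)
  proof
    assume *: "a < (p - 1) * (M - n / 2)"
    define g where "g = (p - 1) * (M - n / 2) - a"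
    have "g > 0" using * by (simp add: g_def)
    then have "\<forall>\<^sub>F t in at_top. t powr b \<le> exp (g * t)"
      by real_asymp
    then show ?thesis
    proof eventually_elim
      case (elim t)
      then have "exp (a * t) * t powr b \<le> exp (a * t) * exp (g * t)"
        by (intro mult_left_mono) auto
      then show ?case by (simp add: g_def algebra_simps flip: exp_add)
    qed
  next
    assume *: "a = (p - 1) * (M - n / 2) \<and> b < - 2"
    have "\<forall>\<^sub>F t in at_top. (t::real) \<ge> 1" by (rule eventually_ge_at_top)
    then show ?thesis
    proof eventually_elim
      case (elim t)
      have "t powr b \<le> t powr 0" using elim * by (intro powr_mono) auto
      then show ?case using elim * by simp
    qed
  qed
  \<comment> \<open>Since \<open>cosh (M * t)\<close> is at least half of
    \<open>exp (M * t)\<close>, the surplus \<open>A - \<epsilon>\<close> provides two quarters: one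
    absorbs the \<open>D\<close> term, the other becomes the constant \<open>c\<close> of
    \<open>blow_up\<close>.\<close>
  have "filterlim (\<lambda>t. (A - \<epsilon>) / 4 * exp (M * t)) at_top at_top"
    using M0 \<epsilon> by (intro filterlim_tendsto_pos_mult_at_top[OF tendsto_const]) (simp, real_asymp)
  then have D_small: "\<forall>\<^sub>F t in at_top. \<bar>D\<bar> \<le> (A - \<epsilon>) / 4 * exp (M * t)"
    by (simp add: filterlim_at_top)
  obtain T where T: "T \<ge> \<delta>" and ev: "\<And>t. t \<ge> T \<Longrightarrow>
      \<bar>LINT x|lebesgue. phi t x\<bar> powr p
        \<le> - \<sigma> * C * (exp (a * t) * t powr b) * nonlin_integral p phi t"
    "\<And>t. t \<ge> T \<Longrightarrow> lam * \<bar>integral {0..\<delta>} (I t)\<bar> \<le> \<epsilon> * cosh (M * t)"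
    "\<And>t. t \<ge> T \<Longrightarrow> exp (a * t) * t powr b \<le> exp ((p - 1) * (M - n / 2) * t)"
    "\<And>t. t \<ge> T \<Longrightarrow> \<bar>D\<bar> \<le> (A - \<epsilon>) / 4 * exp (M * t)"
  proof -
    have "\<forall>\<^sub>F t in at_top. \<bar>LINT x|lebesgue. phi t x\<bar> powr p
          \<le> - \<sigma> * C * (exp (a * t) * t powr b) * nonlin_integral p phi t \<and>
        lam * \<bar>integral {0..\<delta>} (I t)\<bar> \<le> \<epsilon> * cosh (M * t) \<and>
        exp (a * t) * t powr b \<le> exp ((p - 1) * (M - n / 2) * t) \<and>
        \<bar>D\<bar> \<le> (A - \<epsilon>) / 4 * exp (M * t)"
      using C(2) small weight D_small unfolding I_def[abs_def] by (intro eventually_conj)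
    then obtain T0 where T0: "\<And>t. t \<ge> T0 \<Longrightarrow> \<bar>LINT x|lebesgue. phi t x\<bar> powr p
          \<le> - \<sigma> * C * (exp (a * t) * t powr b) * nonlin_integral p phi t \<and>
        lam * \<bar>integral {0..\<delta>} (I t)\<bar> \<le> \<epsilon> * cosh (M * t) \<and>
        exp (a * t) * t powr b \<le> exp ((p - 1) * (M - n / 2) * t) \<and>
        \<bar>D\<bar> \<le> (A - \<epsilon>) / 4 * exp (M * t)"
      unfolding eventually_at_top_linorder by blast
    show ?thesis by (rule that[of "max T0 \<delta>"]) (use T0 in auto)
  qed
  have abs_\<sigma>: "\<bar>\<sigma>\<bar> = 1" using \<open>\<sigma> \<in> {1, -1}\<close> by auto
  have K0: "0 \<le> K s" if "s \<ge> \<delta>" for s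
  proof -
    have "0 \<le> exp (n / 2 * s) * - (\<sigma> * nonlin_integral p phi s)"
      using sign[OF that] by (intro mult_nonneg_nonneg) auto
    then show ?thesis by (simp add: K_def)
  qed
  have K_int: "(\<lambda>s. sinh (M * (t - s)) / M * K s) integrable_on {r..t}" if "0 \<le> r" "r \<le> t" for r t
    unfolding I_K
    by (rule integrable_on_mult_right, rule integrable_on_subinterval[OF I_int]) (use that in auto)
  have lower: "(A - \<epsilon>) / 4 * exp (M * t) +
      lam * integral {T..t} (\<lambda>s. sinh (M * (t - s)) / M * K s) \<le> W t" if t: "t \<ge> T" for t
  proof -
    have t0: "0 \<le> t" "\<delta> \<le> t" using t T \<delta> by auto
    \<comment> \<open>After \<open>\<delta>\<close> the integrand is non-negative, so dropping the
      part before \<open>T\<close> only lowers the integral.\<close>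
    have "integral {T..t} (\<lambda>s. sinh (M * (t - s)) / M * K s) \<le>
        integral {\<delta>..t} (\<lambda>s. sinh (M * (t - s)) / M * K s)"
      using T t \<delta> M0 K0
      by (intro integral_subset_le K_int) (auto intro!: mult_nonneg_nonneg divide_nonneg_pos)
    also have "\<dots> = - \<sigma> * integral {\<delta>..t} (I t)"
      unfolding I_K by (rule integral_mult_right)
    finally have "lam * integral {T..t} (\<lambda>s. sinh (M * (t - s)) / M * K s) \<le>
        lam * (- \<sigma> * integral {\<delta>..t} (I t))"
      using \<open>lam > 0\<close> by (intro mult_left_mono) auto
    then have "lam * integral {T..t} (\<lambda>s. sinh (M * (t - s)) / M * K s) \<le>
        - (\<sigma> * (lam * integral {\<delta>..t} (I t)))"
      by (simp only: mult_minus_left mult_minus_right mult.left_commute)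
    moreover have "integral {0..t} (I t) = integral {0..\<delta>} (I t) + integral {\<delta>..t} (I t)"
      using Henstock_Kurzweil_Integration.integral_combine[OF _ _ I_int[OF t0(1)], of \<delta>] \<delta> t0 by simp
    moreover have "\<sigma> * (lam * integral {0..\<delta>} (I t)) \<le> \<epsilon> * cosh (M * t)"
    proof -
      have "\<sigma> * (lam * integral {0..\<delta>} (I t)) \<le> \<bar>\<sigma> * (lam * integral {0..\<delta>} (I t))\<bar>"
        by (rule abs_ge_self)
      also have "\<dots> = lam * \<bar>integral {0..\<delta>} (I t)\<bar>"
        using abs_\<sigma> \<open>lam > 0\<close> by (simp add: abs_mult)
      finally show ?thesis using ev(2)[OF t] by linarith
    qed
    moreover have "D * exp (- M * t) \<le> (A - \<epsilon>) / 4 * exp (M * t)"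
    proof -
      have "D * exp (- M * t) \<le> \<bar>D\<bar> * 1"
        using t0 M0 by (intro mult_mono) auto
      then show ?thesis using ev(4)[OF t] by linarith
    qed
    moreover have "2 * ((A - \<epsilon>) / 4 * exp (M * t)) \<le> A * cosh (M * t) - \<epsilon> * cosh (M * t)"
    proof -
      have "(A - \<epsilon>) * exp (M * t) \<le> (A - \<epsilon>) * (2 * cosh (M * t))"
        using \<epsilon> by (intro mult_left_mono) (auto simp: cosh_field_def)
      then show ?thesis by (simp add: left_diff_distrib)
    qed
    ultimately show ?thesis
      using W_eq[OF t0(1)] by (simp only: distrib_left)
  qed
  \<comment> \<open>\<open>C\<close> may be 0, so \<open>C + 1\<close> is used to obtain a positive
    constant \<open>\<kappa>\<close>.\<close>
  have K_lower: "1 / (C + 1) * (exp (- ((p - 1) * M * s)) * W s powr p) \<le> K s" if s: "s \<ge> T" for s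
  proof -
    let ?F = "\<bar>LINT x|lebesgue. phi s x\<bar>" and ?N = "- \<sigma> * nonlin_integral p phi s"
    have N0: "0 \<le> ?N" using sign[of s] s T by simp
    have "0 \<le> integral {T..s} (\<lambda>r. sinh (M * (s - r)) / M * K r)"
      using s T \<delta> M0 K0
      by (intro Henstock_Kurzweil_Integration.integral_nonneg K_int) (auto intro!: mult_nonneg_nonneg divide_nonneg_pos)
    \<comment> \<open>The weighted condition concerns the absolute value of the space integral; a
      non-negative \<open>W\<close> can be identified with it up to the exponential factor.\<close>
    then have "0 \<le> W s"
      using lower[OF s] \<epsilon> \<open>lam > 0\<close>
      by (smt (verit) divide_pos_pos exp_gt_zero mult_nonneg_nonneg mult_pos_pos)
    then have "W s = \<bar>W s\<bar>" by simp
    also have "\<dots> = exp (n / 2 * s) * ?F" by (simp add: W_def abs_mult abs_\<sigma>)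
    finally have "W s powr p = exp (n / 2 * s * p) * ?F powr p"
      by (simp add: powr_mult exp_powr_real)
    also have "?F powr p \<le> C * (exp (a * s) * s powr b) * ?N"
      using ev(1)[OF s] by (simp add: ac_simps)
    also have "\<dots> \<le> (C + 1) * exp ((p - 1) * (M - n / 2) * s) * ?N"
      using ev(3)[OF s] C(1) N0 by (intro mult_right_mono mult_mono) auto
    finally have "W s powr p \<le> exp (n / 2 * s * p) * ((C + 1) * exp ((p - 1) * (M - n / 2) * s) * ?N)"
      by simp
    then have "1 / (C + 1) * (exp (- ((p - 1) * M * s)) * W s powr p) \<le> 1 / (C + 1) *
        (exp (- ((p - 1) * M * s)) *
          (exp (n / 2 * s * p) * ((C + 1) * exp ((p - 1) * (M - n / 2) * s) * ?N)))"
      using C(1) by (intro mult_left_mono) auto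
    also have "\<dots> = exp (- ((p - 1) * M * s)) * exp (n / 2 * s * p) * exp ((p - 1) * (M - n / 2) * s) * ?N"
      using C(1) by simp
    \<comment> \<open>The critical exponent enters here: the terms with \<open>M\<close> cancel and
      \<open>n / 2 * p - n / 2 * (p - 1) = n / 2\<close> remains, the weight in
      \<open>K\<close>.\<close>
    also have "exp (- ((p - 1) * M * s)) * exp (n / 2 * s * p) * exp ((p - 1) * (M - n / 2) * s) =
        exp (n / 2 * s)"
      by (simp add: field_simps flip: exp_add)
    finally show ?thesis unfolding K_def .
  qed
  have T0: "0 \<le> T" using T \<delta> by simp
  show False
    by (rule blow_up[OF \<open>p > 1\<close> M0 \<open>lam > 0\<close> _ _ K_int[OF T0] K_lower lower])
      (use C(1) \<epsilon> in auto)
qed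

end
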